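(* Let $\Gamma$ be a finitely generated sofic group with sofic approximation $\mathcal{G}=\{X_i\}_{i\in\mathbb{N}}$. Then $\Gamma$ is a-T-menable if and only if there are $Z_i\subset X_i$ ($i\in\mathbb{N}$) such that $\lim_{i\to\infty}\frac{|Z_i|}{|X_i|}=0$ and the sequence $\{X_i\setminus Z_i\}_{i\in\mathbb{N}}$, equipped with the restriction of the original metric of the sofic approximation, is asymptotically coarsely embeddable into a Hilbert space $\mathcal{H}$.
   Context: Groups are infinite, and $S$ is a finite generating set of $\Gamma$. For finite $F\subset\Gamma$ and $\varepsilon>0$, an $(F,\varepsilon)$-injective almost action on a finite set $X$ is a map $\sigma:\Gamma\to\mathrm{Sym}(X)$ for which there is $Y\subset X$ with $|Y|\ge(1-\varepsilon)|X|$, $\sigma(g)\sigma(h)(y)=\sigma(gh)(y)$ for all $g,h\in F$, $y\in Y$, and $\sigma(g)(y)\ne y$ for all $g\in F\setminus\{e\}$, $y\in Y$. $\Gamma$ is sofic if such almost actions exist for all $F,\varepsilon$. A sofic approximation is a sequence of finite sets $X_i$ with $(F_i,\varepsilon_i)$-injective almost actions $\sigma_i$, where $F_i$ is a nested sequence of finite subsets exhausting $\Gamma$ and $\varepsilon_i\to0$ (hence $|X_i|\to\infty$). Each $X_i$ is regarded as an $S$-labelled graph with edges joining $x$ to $\sigma_i(s)x$, $s\in S$, $x\in X_i$, with its path-length metric $d$; these graphs are assumed connected. $\Gamma$ is a-T-menable if there is a proper function $\psi:\Gamma\to\mathbb{R}$ with $\psi(e)=0$, $\psi(g)=\psi(g^{-1})$,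 and $\sum_{i,j}\lambda_i\lambda_j\psi(g_i^{-1}g_j)\le0$ for all $g_1,\dots,g_n\in\Gamma$ and reals $\lambda_i$ with $\sum_i\lambda_i=0$. A sequence of finite metric spaces $(Y_i,d)$ is asymptotically coarsely embeddable into a Hilbert space if there are symmetric kernels $K_i:Y_i\times Y_i\to\mathbb{R}$, non-decreasing functions $\rho_1,\rho_2:\mathbb{R}_+\to\mathbb{R}$ tending to infinity at infinity, and non-negative reals $R_i\to\infty$ such that: (1) for every sequence $x_i\in Y_i$, $K_i(x_i,x_i)\to0$ as $i\to\infty$; (2) $\rho_1(d(x,y))\le K_i(x,y)\le\rho_2(d(x,y))$ for all $i$ and $x,y\in Y_i$; (3) for every $i$, every subset $\{x_1,\dots,x_n\}\subseteq Y_i$ of diameter smaller than $2R_i$ and all reals $\lambda_k$ with $\sum_k\lambda_k=0$, $\sum_{k,l}\lambda_k\lambda_lK_i(x_k,x_l)\le0$. *)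

theory Defs
  imports
    "HOL-Analysis.Analysis"
    "HOL-Algebra.Generated_Groups"
    "HOL-Combinatorics.Permutations"
begin

definition injective_almost_action ::
  "('g, 'm) monoid_scheme \<Rightarrow> 'g set \<Rightarrow> real \<Rightarrow> 'x set \<Rightarrow> ('g \<Rightarrow> 'x \<Rightarrow> 'x) \<Rightarrow> bool" where
  "injective_almost_action G F \<epsilon> X \<sigma> \<longleftrightarrow>
     finite X \<and> X \<noteq> {} \<and>
     (\<forall>g\<in>carrier G. \<sigma> g permutes X) \<and>
     (\<exists>Y\<subseteq>X. real (card Y) \<ge> (1 - \<epsilon>) * real (card X) \<and>
        (\<forall>g\<in>F. \<forall>h\<in>F. \<forall>y\<in>Y. \<sigma> g (\<sigma> h y) = \<sigma> (g \<otimes>\<^bsub>G\<^esub> h) y) \<and>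
        (\<forall>g\<in>F - {\<one>\<^bsub>G\<^esub>}. \<forall>y\<in>Y. \<sigma> g y \<noteq> y))"

text \<open>Every finite set is in bijection with a finite set of natural numbers, so letting \<open>X\<close>
  range over the latter loses no generality.\<close>

definition sofic :: "('g, 'm) monoid_scheme \<Rightarrow> bool" where
  "sofic G \<longleftrightarrow>
     (\<forall>F \<epsilon>. finite F \<and> F \<subseteq> carrier G \<and> \<epsilon> > 0 \<longrightarrow>
        (\<exists>(X :: nat set) \<sigma>. injective_almost_action G F \<epsilon> X \<sigma>))"

definition sofic_approximation ::
  "('g, 'm) monoid_scheme \<Rightarrow> (nat \<Rightarrow> 'x set) \<Rightarrow> (nat \<Rightarrow> 'g \<Rightarrow> 'x \<Rightarrow> 'x) \<Rightarrow> bool" where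
  "sofic_approximation G X \<sigma> \<longleftrightarrow>
     (\<exists>F \<epsilon>. incseq F \<and> (\<forall>i. finite (F i)) \<and> (\<Union>i. F i) = carrier G \<and>
        (\<forall>i. \<epsilon> i > 0) \<and> \<epsilon> \<longlonglongrightarrow> 0 \<and>
        (\<forall>i. injective_almost_action G (F i) (\<epsilon> i) (X i) (\<sigma> i)))"

text \<open>The graph is undirected; labels and multiplicities of edges play no role for path lengths,
  so only the symmetric adjacency relation is recorded.\<close>

definition graph_edges :: "'g set \<Rightarrow> 'x set \<Rightarrow> ('g \<Rightarrow> 'x \<Rightarrow> 'x) \<Rightarrow> ('x \<times> 'x) set" where
  "graph_edges S X \<sigma> =
     {(x, y). x \<in> X \<and> y \<in> X \<and> (\<exists>s\<in>S. y = \<sigma> s x \<or> x = \<sigma> s y)}"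

definition graph_connected :: "'g set \<Rightarrow> 'x set \<Rightarrow> ('g \<Rightarrow> 'x \<Rightarrow> 'x) \<Rightarrow> bool" where
  "graph_connected S X \<sigma> \<longleftrightarrow> (\<forall>x\<in>X. \<forall>y\<in>X. (x, y) \<in> (graph_edges S X \<sigma>)\<^sup>*)"

definition path_metric :: "'g set \<Rightarrow> 'x set \<Rightarrow> ('g \<Rightarrow> 'x \<Rightarrow> 'x) \<Rightarrow> 'x \<Rightarrow> 'x \<Rightarrow> real" where
  "path_metric S X \<sigma> x y = real (LEAST n. (x, y) \<in> graph_edges S X \<sigma> ^^ n)"

lemma sym_graph_edges: "sym (graph_edges S X \<sigma>)"
  by (auto simp: graph_edges_def sym_def)

lemma relpow_sym:
  assumes "sym E" and "(x, y) \<in> E ^^ n"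
  shows "(y, x) \<in> E ^^ n"
  using assms(2)
proof (induction n arbitrary: y)
  case (Suc n)
  then obtain z where "(x, z) \<in> E ^^ n" "(z, y) \<in> E" by auto
  with Suc.IH assms(1) show ?case by (meson relpow_Suc_I2 symD)
qed auto

lemma Metric_space_path_metric:
  assumes "graph_connected S X \<sigma>"
  shows "Metric_space X (path_metric S X \<sigma>)"
proof -
  define E where "E = graph_edges S X \<sigma>"
  define D where "D x y = (LEAST n. (x, y) \<in> E ^^ n)" for x y
  have D: "path_metric S X \<sigma> x y = real (D x y)" for x y
    by (simp add: path_metric_def D_def E_def)
  have walk: "(x, y) \<in> E ^^ D x y" if "x \<in> X" "y \<in> X" for x y
  proof -
    from assms that have "(x, y) \<in> E\<^sup>*" by (simp add: graph_connected_def E_def)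
    then obtain n where "(x, y) \<in> E ^^ n" using rtrancl_imp_relpow by blast
    then show ?thesis unfolding D_def by (rule LeastI)
  qed
  have le: "D x y \<le> n" if "(x, y) \<in> E ^^ n" for x y n
    unfolding D_def using that by (rule Least_le)
  have comm: "D x y = D y x" for x y
    unfolding D_def using relpow_sym[OF sym_graph_edges] by (metis E_def)
  show ?thesis
  proof
    fix x y assume xy: "x \<in> X" "y \<in> X"
    show "path_metric S X \<sigma> x y = 0 \<longleftrightarrow> x = y"
      using walk[OF xy] le[of x y 0] by (auto simp: D)
  next
    fix x y z assume "x \<in> X" "y \<in> X" "z \<in> X"
    then have "(x, z) \<in> E ^^ (D x y + D y z)"
      using walk[of x y] walk[of y z] by (auto simp: relpow_add)
    from le[OF this] show "path_metric S X \<sigma> x z \<le> path_metric S X \<sigma> x y + path_metric S X \<sigma> y z"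
      by (simp add: D)
  qed (auto simp: D comm)
qed

definition a_T_menable :: "('g, 'm) monoid_scheme \<Rightarrow> bool" where
  "a_T_menable G \<longleftrightarrow>
     (\<exists>\<psi> :: 'g \<Rightarrow> real.
        (\<forall>C. finite {g \<in> carrier G. \<bar>\<psi> g\<bar> \<le> C}) \<and>
        \<psi> \<one>\<^bsub>G\<^esub> = 0 \<and>
        (\<forall>g\<in>carrier G. \<psi> g = \<psi> (inv\<^bsub>G\<^esub> g)) \<and>
        (\<forall>(n :: nat) g (l :: nat \<Rightarrow> real).
           (\<forall>i<n. g i \<in> carrier G) \<and> (\<Sum>i<n. l i) = 0 \<longrightarrow>
           (\<Sum>i<n. \<Sum>j<n. l i * l j * \<psi> (inv\<^bsub>G\<^esub> (g i) \<otimes>\<^bsub>G\<^esub> g j)) \<le> 0))"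

definition finite_diameter :: "('x \<Rightarrow> 'x \<Rightarrow> real) \<Rightarrow> 'x set \<Rightarrow> real" where
  "finite_diameter d A = Max ((\<lambda>(x, y). d x y) ` (A \<times> A))"

text \<open>In the condition on the diagonal of \<open>K\<close> below, \<open>x i \<in> Y i\<close> is only required for all large \<open>i\<close>. For nonempty
  \<open>Y i\<close> this is the same as quantifying over all sequences with \<open>x i \<in> Y i\<close> for every \<open>i\<close>, but
  the condition does not become vacuous if finitely many of the \<open>Y i\<close> are empty.
  In the last condition, the case \<open>n = 0\<close> (where \<open>finite_diameter\<close> has no meaning) holds trivially.\<close>

definition asymp_coarsely_embeddable ::
  "(nat \<Rightarrow> 'x set) \<Rightarrow> (nat \<Rightarrow> 'x \<Rightarrow> 'x \<Rightarrow> real) \<Rightarrow> bool" where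
  "asymp_coarsely_embeddable Y d \<longleftrightarrow>
     (\<exists>(K :: nat \<Rightarrow> 'x \<Rightarrow> 'x \<Rightarrow> real) (\<rho>\<^sub>1 :: real \<Rightarrow> real) (\<rho>\<^sub>2 :: real \<Rightarrow> real) (R :: nat \<Rightarrow> real).
        (\<forall>i. \<forall>x\<in>Y i. \<forall>y\<in>Y i. K i x y = K i y x) \<and>
        mono_on {0..} \<rho>\<^sub>1 \<and> filterlim \<rho>\<^sub>1 at_top at_top \<and>
        mono_on {0..} \<rho>\<^sub>2 \<and> filterlim \<rho>\<^sub>2 at_top at_top \<and>
        (\<forall>i. R i \<ge> 0) \<and> filterlim R at_top sequentially \<and>
        (\<forall>x. (\<forall>\<^sub>F i in sequentially. x i \<in> Y i) \<longrightarrow> (\<lambda>i. K i (x i) (x i)) \<longlonglongrightarrow> 0) \<and>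
        (\<forall>i. \<forall>x\<in>Y i. \<forall>y\<in>Y i. \<rho>\<^sub>1 (d i x y) \<le> K i x y \<and> K i x y \<le> \<rho>\<^sub>2 (d i x y)) \<and>
        (\<forall>i (n :: nat) x (l :: nat \<Rightarrow> real).
           (\<forall>k<n. x k \<in> Y i) \<and> finite_diameter (d i) (x ` {..<n}) < 2 * R i \<and>
           (\<Sum>k<n. l k) = 0 \<longrightarrow>
           (\<Sum>k<n. \<Sum>m<n. l k * l m * K i (x k) (x m)) \<le> 0))"

end

theory Submission
  imports Defs "HOL-Complex_Analysis.Great_Picard"
begin

text \<open>The link between \<open>\<Gamma>\<close> and the graphs \<open>X i\<close> is that almost every point \<open>x\<close> of \<open>X i\<close> is good: on the
  finite set \<open>F i\<close> the almost action is multiplicative and free at \<open>x\<close>. Around such a point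
  \<open>g \<mapsto> \<sigma> g x\<close> is a bijection from a ball of the Cayley graph onto a ball of \<open>X i\<close>, and the distance
  from \<open>x\<close> to \<open>\<sigma> g x\<close> is the word length of \<open>g\<close> (\<open>walk_iff\<close>, \<open>path_metric_act\<close>). The radius of
  these balls tends to infinity with \<open>i\<close>.

  Let \<open>\<psi>\<close> be a proper function of negative type on \<open>\<Gamma>\<close>. Take for \<open>Z i\<close> the set of bad points, and for
  good points \<open>x\<close> and \<open>y = \<sigma> g x\<close> within the faithful range put \<open>K i x y = \<psi> g\<close>. Properness and finiteness
  of balls bound \<open>\<psi>\<close> from both sides by functions of the word length, which is the distance. A set
  whose diameter is within the range is a copy of a finite subset of \<open>\<Gamma>\<close>, so the kernel inherits negative
  type from \<open>\<psi>\<close> there (\<open>kernel_negative_type\<close>). Outside the range no negativity is asked for, and the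
  lower growth bound serves as the value.

  Conversely, let kernels \<open>K i\<close> on \<open>X i - Z i\<close> be given. Average \<open>K i y (\<sigma> g y)\<close> over the points \<open>y\<close>
  of \<open>X i\<close>, leaving out those where \<open>y\<close> or \<open>\<sigma> g y\<close> is bad or in \<open>Z i\<close>. For fixed \<open>g\<close> the terms lie between
  two constants that depend on the length of \<open>g\<close> only, so along a subsequence the averages converge
  for every \<open>g\<close> of the countable group (\<open>convergent_means\<close>). The lower control function makes the limit
  proper (\<open>limit_lower_bound\<close>), and the diagonal condition makes it vanish at the identity
  (\<open>limit_one\<close>). For negative type (\<open>limit_negative_type\<close>), average the inequality for the points
  \<open>\<sigma> (inv (g k)) x\<close> over \<open>x\<close>: since \<open>\<sigma> (inv (g m))\<close> is a permutation, the average of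
  \<open>K i\<close> at the \<open>m\<close>-th and \<open>k\<close>-th of these points agrees, up to the contribution of a set of vanishing
  density, with the average belonging to \<open>inv (g k) \<otimes> g m\<close> (\<open>mean_translate\<close>). Symmetrizing the limit
  gives the required function.\<close>

section \<open>Word length in the Cayley graph\<close>

locale generated_group = group G for G (structure) +
  fixes S
  assumes finite_gens: "finite S" and gens: "S \<subseteq> carrier G"
    and generates: "generate G S = carrier G"
begin

abbreviation cayley_edges :: "('a \<times> 'a) set" where
  "cayley_edges \<equiv> graph_edges S (carrier G) (\<lambda>s x. s \<otimes> x)"

definition walk_ends :: "nat \<Rightarrow> 'a set" where
  "walk_ends n = {g. (\<one>, g) \<in> cayley_edges ^^ n}"

definition word_length :: "'a \<Rightarrow> nat" where
  "word_length g = (LEAST n. g \<in> walk_ends n)"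

definition word_ball :: "nat \<Rightarrow> 'a set" where
  "word_ball n = {g \<in> carrier G. word_length g \<le> n}"

lemma walk_ends_0 [simp]: "walk_ends 0 = {\<one>}"
  by (auto simp: walk_ends_def)

lemma walk_ends_Suc:
  "walk_ends (Suc n) = {h. \<exists>g\<in>walk_ends n. (g, h) \<in> cayley_edges}"
  by (auto simp: walk_ends_def)

lemma walk_ends_carrier: "walk_ends n \<subseteq> carrier G"
  by (cases n) (auto simp: walk_ends_Suc graph_edges_def)

lemma cayley_walk_right_mult:
  assumes "(g, h) \<in> cayley_edges ^^ n" and "k \<in> carrier G"
  shows "(g \<otimes> k, h \<otimes> k) \<in> cayley_edges ^^ n"
  using assms(1)
proof (induction n arbitrary: h)
  case (Suc n)
  then obtain u where u: "(g, u) \<in> cayley_edges ^^ n" "(u, h) \<in> cayley_edges" by auto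
  from u(2) obtain s where s: "s \<in> S" "u \<in> carrier G" "h \<in> carrier G" "h = s \<otimes> u \<or> u = s \<otimes> h"
    by (auto simp: graph_edges_def)
  have "s \<in> carrier G" using s(1) gens by auto
  then have "(u \<otimes> k, h \<otimes> k) \<in> cayley_edges"
    using s assms(2) m_assoc unfolding graph_edges_def by auto
  with Suc.IH[OF u(1)] show ?case by auto
qed auto

lemma walk_ends_mult:
  assumes "g \<in> walk_ends m" and "h \<in> walk_ends n"
  shows "g \<otimes> h \<in> walk_ends (n + m)"
proof -
  have hc: "h \<in> carrier G" using assms(2) walk_ends_carrier by auto
  then have "(h, g \<otimes> h) \<in> cayley_edges ^^ m"
    using cayley_walk_right_mult[of \<one> g m h] assms(1) by (simp add: walk_ends_def)
  then show ?thesis using assms(2) by (auto simp: walk_ends_def relpow_add)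
qed

lemma walk_ends_inv:
  assumes "g \<in> walk_ends n"
  shows "inv g \<in> walk_ends n"
proof -
  have gc: "g \<in> carrier G" using assms walk_ends_carrier by auto
  then have "(inv g, \<one>) \<in> cayley_edges ^^ n"
    using cayley_walk_right_mult[of \<one> g n "inv g"] assms by (simp add: walk_ends_def)
  from relpow_sym[OF sym_graph_edges this] show ?thesis by (simp add: walk_ends_def)
qed

lemma gen_walk_ends: "s \<in> S \<Longrightarrow> s \<in> walk_ends 1"
  using gens by (force simp: walk_ends_def graph_edges_def)

lemma walk_ends_exhaust:
  assumes "g \<in> carrier G"
  shows "\<exists>n. g \<in> walk_ends n"
proof -
  from assms have "g \<in> generate G S" by (simp add: generates)
  then show ?thesis
  proof induction
    case one
    have "\<one> \<in> walk_ends 0" by simp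
    then show ?case by blast
  next
    case (incl h) then show ?case using gen_walk_ends by blast
  next
    case (inv h) then show ?case using gen_walk_ends walk_ends_inv by blast
  next
    case (eng h1 h2) then show ?case using walk_ends_mult by blast
  qed
qed

lemma walk_ends_word_length: "g \<in> carrier G \<Longrightarrow> g \<in> walk_ends (word_length g)"
  unfolding word_length_def using walk_ends_exhaust by (metis LeastI)

lemma word_length_le: "g \<in> walk_ends n \<Longrightarrow> word_length g \<le> n"
  unfolding word_length_def by (rule Least_le)

lemma walk_ends_word_ball: "k \<le> n \<Longrightarrow> walk_ends k \<subseteq> word_ball n"
  using word_length_le walk_ends_carrier by (force simp: word_ball_def)

lemma finite_walk_ends: "finite (walk_ends n)"
proof (induction n)
  case (Suc n)
  have "walk_ends (Suc n) \<subseteq> (\<Union>g\<in>walk_ends n. (\<lambda>s. s \<otimes> g) ` S \<union> (\<lambda>s. inv s \<otimes> g) ` S)"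
  proof
    fix h assume "h \<in> walk_ends (Suc n)"
    then obtain g s where gs: "g \<in> walk_ends n" "s \<in> S" "g \<in> carrier G" "h \<in> carrier G"
      "h = s \<otimes> g \<or> g = s \<otimes> h"
      by (auto simp: walk_ends_Suc graph_edges_def)
    have "s \<in> carrier G" using gs gens by auto
    then have "h = s \<otimes> g \<or> h = inv s \<otimes> g" using gs inv_solve_left by blast
    then show "h \<in> (\<Union>g\<in>walk_ends n. (\<lambda>s. s \<otimes> g) ` S \<union> (\<lambda>s. inv s \<otimes> g) ` S)"
      using gs by blast
  qed
  then show ?case by (rule finite_subset) (use Suc finite_gens in auto)
qed auto

lemma finite_word_ball: "finite (word_ball n)"
proof -
  have "word_ball n \<subseteq> (\<Union>k\<le>n. walk_ends k)"
    using walk_ends_word_length by (auto simp: word_ball_def)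
  then show ?thesis by (rule finite_subset) (simp add: finite_walk_ends)
qed

lemma word_ball_mono: "m \<le> n \<Longrightarrow> word_ball m \<subseteq> word_ball n"
  by (auto simp: word_ball_def)

lemma word_ball_carrier: "word_ball n \<subseteq> carrier G"
  by (auto simp: word_ball_def)

lemma word_length_one [simp]: "word_length \<one> = 0"
  using word_length_le[of \<one> 0] by simp

lemma one_word_ball [simp]: "\<one> \<in> word_ball n"
  by (auto simp: word_ball_def)

lemma word_ball_inv: "g \<in> word_ball n \<Longrightarrow> inv g \<in> word_ball n"
  using walk_ends_word_length walk_ends_inv word_length_le by (force simp: word_ball_def)

lemma word_ball_mult:
  assumes "g \<in> word_ball m" and "h \<in> word_ball n"
  shows "g \<otimes> h \<in> word_ball (m + n)"
proof -
  have "g \<otimes> h \<in> walk_ends (word_length h + word_length g)"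
    using assms walk_ends_mult walk_ends_word_length by (auto simp: word_ball_def)
  then show ?thesis
    using walk_ends_word_ball[of "word_length h + word_length g" "m + n"] assms
    by (auto simp: word_ball_def)
qed

end

section \<open>Good points of an almost action\<close>

text \<open>A good point for \<open>F\<close> is one at which \<open>\<sigma>\<close> behaves on \<open>F\<close> like a free action.\<close>

locale good_point = generated_group +
  fixes F :: "'a set" and V :: "'x set" and \<sigma> :: "'a \<Rightarrow> 'x \<Rightarrow> 'x" and x :: 'x
  assumes perm: "g \<in> carrier G \<Longrightarrow> \<sigma> g permutes V"
    and in_V: "x \<in> V"
    and act: "\<lbrakk>g \<in> F; h \<in> F\<rbrakk> \<Longrightarrow> \<sigma> g (\<sigma> h x) = \<sigma> (g \<otimes> h) x"
    and free: "\<lbrakk>g \<in> F; g \<noteq> \<one>\<rbrakk> \<Longrightarrow> \<sigma> g x \<noteq> x"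
begin

lemma act_in_V: "g \<in> carrier G \<Longrightarrow> \<sigma> g x \<in> V"
  using perm in_V by (simp add: permutes_in_image)

text \<open>Multiplicativity at \<open>(\<one>, \<one>)\<close> already makes \<open>\<sigma> \<one>\<close> fix a good point, because
  \<open>\<sigma> \<one>\<close> is injective.\<close>

lemma act_one: "\<one> \<in> F \<Longrightarrow> \<sigma> \<one> x = x"
  using act[of \<one> \<one>] permutes_inj[OF perm[of \<one>]] by (auto dest: injD)

text \<open>Comparing \<open>g\<close> and \<open>h\<close> means applying freeness to \<open>inv h \<otimes> g\<close>, hence the doubled radius.\<close>

lemma act_inj:
  assumes ball: "word_ball (2 * n) \<subseteq> F"
    and g: "g \<in> word_ball n" and h: "h \<in> word_ball n" and eq: "\<sigma> g x = \<sigma> h x"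
  shows "g = h"
proof -
  have F: "g \<in> F" "h \<in> F" "inv h \<in> F" "\<one> \<in> F"
    using g h ball word_ball_mono[of n "2 * n"] word_ball_inv by auto
  have c: "g \<in> carrier G" "h \<in> carrier G" using g h word_ball_carrier by auto
  have hg: "inv h \<otimes> g \<in> F"
    using word_ball_mult[OF word_ball_inv[OF h] g] ball by (simp add: mult_2 subset_iff)
  have "\<sigma> (inv h \<otimes> g) x = \<sigma> (inv h \<otimes> h) x"
    using act[of "inv h" g] act[of "inv h" h] F eq by simp
  then have "\<sigma> (inv h \<otimes> g) x = x" using c act_one F by simp
  then have "inv h \<otimes> g = \<one>" using free hg by blast
  then show ?thesis using c by (metis inv_closed inv_equality inv_inv)
qed

text \<open>Walks from a good point follow walks from \<open>\<one>\<close> in the Cayley graph. Traversing an edge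
  backwards multiplies by the inverse of a generator, since \<open>\<sigma> s\<close> is injective.\<close>

lemma walk_iff:
  assumes "word_ball n \<subseteq> F"
  shows "(x, y) \<in> graph_edges S V \<sigma> ^^ n \<longleftrightarrow> (\<exists>g\<in>walk_ends n. y = \<sigma> g x)"
  using assms
proof (induction n arbitrary: y)
  case 0
  have "\<one> \<in> F" using 0 one_word_ball by auto
  then show ?case using act_one by auto
next
  case (Suc n)
  have sub: "word_ball n \<subseteq> F" using Suc.prems word_ball_mono[of n "Suc n"] by auto
  have F: "walk_ends n \<subseteq> F" "walk_ends (Suc n) \<subseteq> F" "S \<subseteq> F"
    using Suc.prems walk_ends_word_ball[of n "Suc n"] walk_ends_word_ball[of "Suc n" "Suc n"]
      walk_ends_word_ball[of 1 "Suc n"] gen_walk_ends by fastforce+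
  show ?case
  proof
    assume "(x, y) \<in> graph_edges S V \<sigma> ^^ Suc n"
    then obtain z where "(x, z) \<in> graph_edges S V \<sigma> ^^ n" and zy: "(z, y) \<in> graph_edges S V \<sigma>"
      by auto
    then obtain g where g: "g \<in> walk_ends n" "z = \<sigma> g x" using Suc.IH sub by blast
    obtain s where s: "s \<in> S" "y = \<sigma> s z \<or> z = \<sigma> s y" using zy by (auto simp: graph_edges_def)
    have c: "g \<in> carrier G" "s \<in> carrier G" using g s gens walk_ends_carrier by auto
    from s(2) show "\<exists>g\<in>walk_ends (Suc n). y = \<sigma> g x"
    proof
      assume y: "y = \<sigma> s z"
      have "s \<otimes> g \<in> walk_ends (Suc n)" using g c s by (auto simp: walk_ends_Suc graph_edges_def)
      then show ?thesis using y g act[of s g] F s by auto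
    next
      assume z: "z = \<sigma> s y"
      have k: "inv s \<otimes> g \<in> walk_ends (Suc n)"
        using walk_ends_mult[OF walk_ends_inv[OF gen_walk_ends[OF s(1)]] g(1)] by simp
      have "\<sigma> s (\<sigma> (inv s \<otimes> g) x) = \<sigma> (s \<otimes> (inv s \<otimes> g)) x"
        using k F s(1) by (intro act) auto
      also have "s \<otimes> (inv s \<otimes> g) = g" using c by (simp add: m_assoc[symmetric])
      finally have "\<sigma> s (\<sigma> (inv s \<otimes> g) x) = \<sigma> s y" using g z by simp
      then have "\<sigma> (inv s \<otimes> g) x = y" using permutes_inj[OF perm[OF c(2)]] by (auto dest: injD)
      then show ?thesis using k by blast
    qed
  next
    assume "\<exists>g\<in>walk_ends (Suc n). y = \<sigma> g x"
    then obtain h where h: "h \<in> walk_ends (Suc n)" "y = \<sigma> h x" by blast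
    then obtain g s where g: "g \<in> walk_ends n" "s \<in> S" "h = s \<otimes> g \<or> g = s \<otimes> h"
      by (auto simp: walk_ends_Suc graph_edges_def)
    have c: "g \<in> carrier G" "h \<in> carrier G" using g h walk_ends_carrier by auto
    have V: "\<sigma> g x \<in> V" "y \<in> V" using c act_in_V h by auto
    have m: "g \<in> F" "h \<in> F" "s \<in> F" using g h F by auto
    have "(x, \<sigma> g x) \<in> graph_edges S V \<sigma> ^^ n" using Suc.IH sub g by blast
    moreover have "(\<sigma> g x, y) \<in> graph_edges S V \<sigma>"
      using g(3)
    proof
      assume "h = s \<otimes> g"
      then have "y = \<sigma> s (\<sigma> g x)" using act[of s g] m h by simp
      then show ?thesis using g(2) V by (auto simp: graph_edges_def)
    next
      assume "g = s \<otimes> h"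
      then have "\<sigma> g x = \<sigma> s y" using act[of s h] m h by simp
      then show ?thesis using g(2) V by (auto simp: graph_edges_def)
    qed
    ultimately show "(x, y) \<in> graph_edges S V \<sigma> ^^ Suc n" by auto
  qed
qed

text \<open>A short walk in \<open>V\<close> between the two points lifts to the Cayley graph, and by injectivity of
  the orbit map on the ball it ends at \<open>g\<close>; so there are no shortcuts.\<close>

lemma path_metric_act:
  assumes ball: "word_ball (2 * n) \<subseteq> F" and g: "g \<in> word_ball n"
  shows "path_metric S V \<sigma> x (\<sigma> g x) = real (word_length g)"
proof -
  let ?P = "\<lambda>k. (x, \<sigma> g x) \<in> graph_edges S V \<sigma> ^^ k"
  have len: "word_length g \<le> n" "g \<in> carrier G" using g by (auto simp: word_ball_def)
  have sub: "word_ball k \<subseteq> F" if "k \<le> n" for k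
    using ball word_ball_mono[of k "2 * n"] that by auto
  have P: "?P (word_length g)"
    using walk_iff[OF sub[OF len(1)]] walk_ends_word_length[OF len(2)] by blast
  then have le: "(LEAST k. ?P k) \<le> word_length g" by (rule Least_le)
  have "?P (LEAST k. ?P k)" using P by (rule LeastI)
  then obtain h where h: "h \<in> walk_ends (LEAST k. ?P k)" "\<sigma> g x = \<sigma> h x"
    using walk_iff[OF sub] le len by (meson order_trans)
  have "h \<in> word_ball n" using h(1) walk_ends_word_ball[of "LEAST k. ?P k" n] le len by auto
  then have "g = h" using act_inj[OF ball g] h(2) by blast
  then have "word_length g \<le> (LEAST k. ?P k)" using h(1) word_length_le by blast
  with le show ?thesis by (simp add: path_metric_def)
qed

lemma path_metric_ball:
  assumes ball: "word_ball n \<subseteq> F" and conn: "graph_connected S V \<sigma>"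
    and y: "y \<in> V" and d: "path_metric S V \<sigma> x y \<le> real n"
  obtains g where "g \<in> word_ball n" "y = \<sigma> g x"
proof -
  let ?P = "\<lambda>k. (x, y) \<in> graph_edges S V \<sigma> ^^ k"
  have "\<exists>k. ?P k" using conn in_V y rtrancl_imp_relpow unfolding graph_connected_def by blast
  then have "?P (LEAST k. ?P k)" by (rule LeastI_ex)
  moreover have le: "(LEAST k. ?P k) \<le> n" using d by (simp add: path_metric_def)
  moreover have "word_ball (LEAST k. ?P k) \<subseteq> F" using ball word_ball_mono[OF le] by auto
  ultimately obtain g where "g \<in> walk_ends (LEAST k. ?P k)" "y = \<sigma> g x" using walk_iff by blast
  then show ?thesis using walk_ends_word_ball[OF le] that by blast
qed

end

locale good_approximation = generated_group +
  fixes X :: "nat \<Rightarrow> 'x set" and \<sigma> :: "nat \<Rightarrow> 'a \<Rightarrow> 'x \<Rightarrow> 'x"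
    and F :: "nat \<Rightarrow> 'a set" and Y :: "nat \<Rightarrow> 'x set"
  assumes F_mono: "incseq F" and F_finite: "finite (F i)" and F_cover: "(\<Union>i. F i) = carrier G"
    and X_finite: "finite (X i)" and X_nonempty: "X i \<noteq> {}"
    and perm: "g \<in> carrier G \<Longrightarrow> \<sigma> i g permutes X i"
    and connected: "graph_connected S (X i) (\<sigma> i)"
    and Y_sub: "Y i \<subseteq> X i"
    and Y_full: "(\<lambda>i. real (card (X i - Y i)) / real (card (X i))) \<longlonglongrightarrow> 0"
    and act: "\<lbrakk>y \<in> Y i; g \<in> F i; h \<in> F i\<rbrakk> \<Longrightarrow> \<sigma> i g (\<sigma> i h y) = \<sigma> i (g \<otimes> h) y"
    and free: "\<lbrakk>y \<in> Y i; g \<in> F i; g \<noteq> \<one>\<rbrakk> \<Longrightarrow> \<sigma> i g y \<noteq> y"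
begin

abbreviation dist_X :: "nat \<Rightarrow> 'x \<Rightarrow> 'x \<Rightarrow> real" where
  "dist_X i \<equiv> path_metric S (X i) (\<sigma> i)"

lemma good_pointI: "y \<in> Y i \<Longrightarrow> good_point G S (F i) (X i) (\<sigma> i) y"
  using perm Y_sub act free by unfold_locales auto

lemma card_X_pos: "card (X i) > 0"
  using X_finite X_nonempty by (simp add: card_gt_0_iff)

lemma eventually_in_F:
  assumes "finite T" and "T \<subseteq> carrier G"
  shows "\<forall>\<^sub>F i in sequentially. T \<subseteq> F i"
proof -
  have "\<forall>\<^sub>F i in sequentially. g \<in> F i" if g: "g \<in> T" for g
  proof -
    obtain j where j: "g \<in> F j" using F_cover assms(2) g by blast
    show ?thesis
      using F_mono j by (intro eventually_sequentiallyI[of j]) (auto simp: incseq_def)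
  qed
  then have "\<forall>\<^sub>F i in sequentially. \<forall>g\<in>T. g \<in> F i"
    by (intro eventually_ball_finite assms(1)) auto
  then show ?thesis by eventually_elim auto
qed

lemma eventually_word_ball: "\<forall>\<^sub>F i in sequentially. word_ball n \<subseteq> F i"
  by (intro eventually_in_F finite_word_ball word_ball_carrier)

end

section \<open>From a proper negative type function to kernels on the approximation\<close>

context generated_group
begin

text \<open>The best bounds for \<open>\<psi>\<close> in terms of word length; they become the control functions of the
  coarse embedding.\<close>

definition lower_growth :: "('a \<Rightarrow> real) \<Rightarrow> real \<Rightarrow> real" where
  "lower_growth \<psi> t = Inf (\<psi> ` {g \<in> carrier G. t \<le> real (word_length g)})"

definition upper_growth :: "('a \<Rightarrow> real) \<Rightarrow> real \<Rightarrow> real" where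
  "upper_growth \<psi> t = Sup (\<psi> ` {g \<in> carrier G. real (word_length g) \<le> t})"

lemma exists_long_word:
  assumes "infinite (carrier G)"
  shows "\<exists>g\<in>carrier G. t \<le> real (word_length g)"
proof (rule ccontr)
  assume "\<not> ?thesis"
  then have lt: "real (word_length g) < t" if "g \<in> carrier G" for g
    using that by (auto simp: not_le)
  have "carrier G \<subseteq> word_ball (nat \<lceil>t\<rceil>)"
  proof
    fix g assume g: "g \<in> carrier G"
    show "g \<in> word_ball (nat \<lceil>t\<rceil>)"
      using lt[OF g] real_nat_ceiling_ge[of t] g by (simp add: word_ball_def) linarith
  qed
  then show False using assms finite_word_ball finite_subset by blast
qed

context
  fixes \<psi> :: "'a \<Rightarrow> real"
  assumes infinite: "infinite (carrier G)"
    and nonneg: "\<And>g. g \<in> carrier G \<Longrightarrow> 0 \<le> \<psi> g"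
begin

lemma lower_growth_le: "\<lbrakk>g \<in> carrier G; t \<le> real (word_length g)\<rbrakk> \<Longrightarrow> lower_growth \<psi> t \<le> \<psi> g"
  unfolding lower_growth_def using nonneg by (intro cInf_lower bdd_belowI[of _ 0]) auto

lemma le_lower_growth:
  assumes "\<And>g. \<lbrakk>g \<in> carrier G; t \<le> real (word_length g)\<rbrakk> \<Longrightarrow> c \<le> \<psi> g"
  shows "c \<le> lower_growth \<psi> t"
  unfolding lower_growth_def using assms exists_long_word[OF infinite, of t]
  by (intro cInf_greatest) auto

lemma lower_growth_mono: "mono (lower_growth \<psi>)"
  by (intro monoI le_lower_growth lower_growth_le) auto

lemma lower_growth_nonneg: "0 \<le> lower_growth \<psi> t"
  using nonneg by (intro le_lower_growth)

text \<open>Properness says exactly that \<open>\<psi>\<close> is large outside a large ball.\<close>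

lemma lower_growth_at_top:
  assumes proper: "\<And>C. finite {g \<in> carrier G. \<bar>\<psi> g\<bar> \<le> C}"
  shows "filterlim (lower_growth \<psi>) at_top at_top"
  unfolding filterlim_at_top
proof
  fix C
  define N where "N = Max (insert 0 (word_length ` {g \<in> carrier G. \<bar>\<psi> g\<bar> \<le> C}))"
  have N: "word_length g \<le> N" if "g \<in> carrier G" "\<psi> g \<le> C" for g
    unfolding N_def using that proper[of C] nonneg[of g] by (intro Max_ge) auto
  show "\<forall>\<^sub>F t in at_top. C \<le> lower_growth \<psi> t"
    using eventually_gt_at_top[of "real N"]
  proof eventually_elim
    case (elim t)
    show ?case using N elim by (intro le_lower_growth) (smt (verit) of_nat_mono)
  qed
qed

lemma upper_growth_finite: "finite (\<psi> ` {g \<in> carrier G. real (word_length g) \<le> t})"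
proof (rule finite_imageI, rule finite_subset[OF _ finite_word_ball])
  show "{g \<in> carrier G. real (word_length g) \<le> t} \<subseteq> word_ball (nat \<lfloor>t\<rfloor>)"
    by (auto simp: word_ball_def le_nat_floor)
qed

lemma le_upper_growth: "\<lbrakk>g \<in> carrier G; real (word_length g) \<le> t\<rbrakk> \<Longrightarrow> \<psi> g \<le> upper_growth \<psi> t"
  unfolding upper_growth_def using upper_growth_finite[of t]
  by (intro cSup_upper bdd_above_finite) auto

lemma upper_growth_mono_on: "mono_on {0..} (upper_growth \<psi>)"
proof (rule mono_onI)
  fix s t :: real assume "s \<in> {0..}" "s \<le> t"
  then show "upper_growth \<psi> s \<le> upper_growth \<psi> t"
    unfolding upper_growth_def using upper_growth_finite[of t]
    by (intro cSup_subset_mono bdd_above_finite) (auto intro!: exI[of _ \<one>])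
qed

lemma upper_growth_nonneg:
  assumes "0 \<le> t"
  shows "0 \<le> upper_growth \<psi> t"
proof -
  have "\<psi> \<one> \<le> upper_growth \<psi> t" using assms by (intro le_upper_growth) auto
  then show ?thesis using nonneg[of \<one>] by simp
qed

end

end

text \<open>A negative type function vanishing at \<open>\<one>\<close> is non-negative: use the two points
  \<open>\<one>\<close>, \<open>g\<close> with coefficients \<open>1\<close>, \<open>-1\<close>.\<close>

lemma (in group) negative_type_nonneg:
  fixes \<psi> :: "'a \<Rightarrow> real"
  assumes one: "\<psi> \<one> = 0" and sym: "\<And>g. g \<in> carrier G \<Longrightarrow> \<psi> g = \<psi> (inv g)"
    and neg: "\<And>(n::nat) g (l :: nat \<Rightarrow> real). \<lbrakk>\<And>i. i < n \<Longrightarrow> g i \<in> carrier G; (\<Sum>i<n. l i) = 0\<rbrakk> \<Longrightarrow>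
      (\<Sum>i<n. \<Sum>j<n. l i * l j * \<psi> (inv (g i) \<otimes> g j)) \<le> 0"
    and g: "g \<in> carrier G"
  shows "0 \<le> \<psi> g"
proof -
  let ?p = "\<lambda>i::nat. if i = 0 then \<one> else g" and ?l = "\<lambda>i::nat. if i = 0 then 1 else - 1 :: real"
  have "(\<Sum>i<2. \<Sum>j<2. ?l i * ?l j * \<psi> (inv (?p i) \<otimes> ?p j)) \<le> 0"
    using g by (intro neg) (auto simp: numeral_2_eq_2)
  then show ?thesis using g one sym[OF g] by (simp add: numeral_2_eq_2)
qed

context good_approximation
begin

text \<open>The largest radius (up to \<open>i\<close>) at which good points of \<open>X i\<close> see an exact copy of the
  Cayley graph. The factor \<open>8\<close> leaves room for comparing two elements of the ball of radius
  \<open>4 r\<close>, which contains the quotients of any two elements of the ball of radius \<open>2 r\<close>.\<close>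

definition faithful_radius :: "nat \<Rightarrow> nat" where
  "faithful_radius i = Max {r. r \<le> i \<and> (r = 0 \<or> word_ball (8 * r) \<subseteq> F i)}"

lemma faithful_radius_ball:
  assumes "faithful_radius i > 0"
  shows "word_ball (8 * faithful_radius i) \<subseteq> F i"
proof -
  have "faithful_radius i \<in> {r. r \<le> i \<and> (r = 0 \<or> word_ball (8 * r) \<subseteq> F i)}"
    unfolding faithful_radius_def by (rule Max_in) (auto intro: finite_subset[of _ "{..i}"])
  then show ?thesis using assms by auto
qed

lemma faithful_radius_at_top: "filterlim (\<lambda>i. real (faithful_radius i)) at_top sequentially"
proof -
  have "filterlim faithful_radius at_top sequentially"
    unfolding filterlim_at_top
  proof
    fix N
    show "\<forall>\<^sub>F i in sequentially. N \<le> faithful_radius i"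
      using eventually_word_ball[of "8 * N"] eventually_ge_at_top[of N]
    proof eventually_elim
      case (elim i)
      then show ?case
        unfolding faithful_radius_def
        by (intro Max_ge) (auto intro: finite_subset[of _ "{..i}"])
    qed
  qed
  then show ?thesis using filterlim_compose[OF filterlim_real_sequentially] by blast
qed

text \<open>Nearby good points are joined by a unique short group element, whose length is their
  distance; the kernel evaluates \<open>\<psi>\<close> there. Beyond the faithful range only the two growth bounds
  matter, so the lower one is used as the value.\<close>

definition connecting :: "nat \<Rightarrow> 'x \<Rightarrow> 'x \<Rightarrow> 'a" where
  "connecting i x y = (THE g. g \<in> word_ball (4 * faithful_radius i) \<and> y = \<sigma> i g x)"

definition pullback_kernel :: "('a \<Rightarrow> real) \<Rightarrow> nat \<Rightarrow> 'x \<Rightarrow> 'x \<Rightarrow> real" where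
  "pullback_kernel \<psi> i x y =
     (if dist_X i x y < 2 * real (faithful_radius i) then \<psi> (connecting i x y)
      else lower_growth \<psi> (dist_X i x y))"

lemma connecting_eq:
  assumes x: "x \<in> Y i" and r: "faithful_radius i > 0"
    and g: "g \<in> word_ball (4 * faithful_radius i)" and y: "y = \<sigma> i g x"
  shows "connecting i x y = g"
proof -
  interpret P: good_point G S "F i" "X i" "\<sigma> i" x using x by (rule good_pointI)
  show ?thesis unfolding connecting_def
  proof (rule the_equality)
    fix h assume h: "h \<in> word_ball (4 * faithful_radius i) \<and> y = \<sigma> i h x"
    have "word_ball (2 * (4 * faithful_radius i)) \<subseteq> F i" using faithful_radius_ball[OF r] by simp
    then show "h = g" using P.act_inj h g y by blast
  qed (use g y in auto)
qed

lemma obtain_connecting: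
  assumes x: "x \<in> Y i" and y: "y \<in> X i" and d: "dist_X i x y < 2 * real (faithful_radius i)"
  obtains g where "g \<in> word_ball (2 * faithful_radius i)" "y = \<sigma> i g x" "connecting i x y = g"
    "dist_X i x y = real (word_length g)" "faithful_radius i > 0"
proof -
  interpret P: good_point G S "F i" "X i" "\<sigma> i" x using x by (rule good_pointI)
  have r: "faithful_radius i > 0" using d by (cases "faithful_radius i") (auto simp: path_metric_def)
  have ball: "word_ball n \<subseteq> F i" if "n \<le> 8 * faithful_radius i" for n
    using faithful_radius_ball[OF r] word_ball_mono[OF that] by auto
  obtain g where g: "g \<in> word_ball (2 * faithful_radius i)" "y = \<sigma> i g x"
    using P.path_metric_ball[OF ball connected y, of "2 * faithful_radius i"] d by auto
  have g4: "g \<in> word_ball (4 * faithful_radius i)" using g(1) by (auto simp: word_ball_def)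
  show ?thesis
    using that[OF g connecting_eq[OF x r g4 g(2)] _ r] P.path_metric_act[OF ball g(1)] g(2) by simp
qed

lemma inverse_act:
  assumes x: "x \<in> Y i" and ball: "word_ball n \<subseteq> F i" and g: "g \<in> word_ball n"
  shows "x = \<sigma> i (inv g) (\<sigma> i g x)"
proof -
  interpret P: good_point G S "F i" "X i" "\<sigma> i" x using x by (rule good_pointI)
  have "\<sigma> i (inv g) (\<sigma> i g x) = \<sigma> i (inv g \<otimes> g) x"
    using word_ball_inv[OF g] g ball by (intro P.act) auto
  also have "\<dots> = x" using P.act_one g ball one_word_ball word_ball_carrier by fastforce
  finally show ?thesis by simp
qed

lemma dist_X_commute: "dist_X i x y = dist_X i y x"
  using Metric_space.commute[OF Metric_space_path_metric[OF connected]] .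

lemma kernel_sym:
  assumes sym: "\<And>g. g \<in> carrier G \<Longrightarrow> \<psi> g = \<psi> (inv g)" and x: "x \<in> Y i" and y: "y \<in> Y i"
  shows "pullback_kernel \<psi> i x y = pullback_kernel \<psi> i y x"
proof (cases "dist_X i x y < 2 * real (faithful_radius i)")
  case True
  obtain g where g: "g \<in> word_ball (2 * faithful_radius i)" "y = \<sigma> i g x" "connecting i x y = g"
    and r: "faithful_radius i > 0"
    using obtain_connecting[OF x _ True] y Y_sub by blast
  have g4: "inv g \<in> word_ball (4 * faithful_radius i)"
    using word_ball_inv[OF g(1)] by (auto simp: word_ball_def)
  have "word_ball (2 * faithful_radius i) \<subseteq> F i"
    using faithful_radius_ball[OF r] word_ball_mono[of "2 * faithful_radius i" "8 * faithful_radius i"] by auto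
  then have "x = \<sigma> i (inv g) y" using inverse_act[OF x _ g(1)] g(2) by simp
  then have "connecting i y x = inv g" using connecting_eq[OF y r g4] by simp
  then show ?thesis
    using True g sym[of g] word_ball_carrier dist_X_commute[of i y x]
    by (auto simp: pullback_kernel_def)
qed (simp add: pullback_kernel_def dist_X_commute[of i y x])

lemma kernel_bounds:
  assumes inf: "infinite (carrier G)" and nonneg: "\<And>g. g \<in> carrier G \<Longrightarrow> 0 \<le> \<psi> g"
    and x: "x \<in> Y i" and y: "y \<in> Y i"
  shows "lower_growth \<psi> (dist_X i x y) \<le> pullback_kernel \<psi> i x y \<and>
    pullback_kernel \<psi> i x y \<le> lower_growth \<psi> (dist_X i x y) + upper_growth \<psi> (dist_X i x y)"
proof (cases "dist_X i x y < 2 * real (faithful_radius i)")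
  case True
  obtain g where g: "g \<in> word_ball (2 * faithful_radius i)" "connecting i x y = g"
     "dist_X i x y = real (word_length g)"
    using obtain_connecting[OF x _ True] y Y_sub by blast
  have gc: "g \<in> carrier G" using g word_ball_carrier by auto
  have "pullback_kernel \<psi> i x y = \<psi> g" using True g by (simp add: pullback_kernel_def)
  then show ?thesis
    using lower_growth_le[of \<psi>, OF inf nonneg gc] le_upper_growth[of \<psi>, OF inf nonneg gc]
      lower_growth_nonneg[of \<psi>, OF inf nonneg] g(3) by (smt (verit))
next
  case False
  then show ?thesis using upper_growth_nonneg[of \<psi>, OF inf nonneg, of "dist_X i x y"]
    by (simp add: pullback_kernel_def path_metric_def)
qed

lemma kernel_diagonal:
  assumes "\<psi> \<one> = 0" and x: "x \<in> Y i" and r: "faithful_radius i > 0"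
  shows "pullback_kernel \<psi> i x x = 0"
proof -
  interpret P: good_point G S "F i" "X i" "\<sigma> i" x using x by (rule good_pointI)
  have "\<one> \<in> F i" using faithful_radius_ball[OF r] one_word_ball by blast
  then have "connecting i x x = \<one>" using connecting_eq[OF x r, of \<one> x] P.act_one by simp
  moreover have "dist_X i x x = 0"
    using Metric_space.mdist_zero[OF Metric_space_path_metric[OF connected]] P.in_V by blast
  ultimately show ?thesis using r assms(1) by (simp add: pullback_kernel_def)
qed

text \<open>A set of small diameter consists of translates \<open>\<sigma> (g k) x\<close> of one of its points \<open>x\<close>, and the
  element connecting \<open>\<sigma> (g k) x\<close> to \<open>\<sigma> (g m) x\<close> is \<open>g m \<otimes> inv (g k)\<close>. So the quadratic form of the kernel
  is that of \<open>\<psi>\<close> at the inverses of the \<open>g k\<close>.\<close>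

lemma kernel_negative_type:
  fixes n :: nat and l :: "nat \<Rightarrow> real"
  assumes sym: "\<And>g. g \<in> carrier G \<Longrightarrow> \<psi> g = \<psi> (inv g)"
    and neg: "\<And>(n::nat) g (l :: nat \<Rightarrow> real). \<lbrakk>\<And>i. i < n \<Longrightarrow> g i \<in> carrier G; (\<Sum>i<n. l i) = 0\<rbrakk> \<Longrightarrow>
      (\<Sum>i<n. \<Sum>j<n. l i * l j * \<psi> (inv (g i) \<otimes> g j)) \<le> 0"
    and x: "\<And>k. k < n \<Longrightarrow> x k \<in> Y i"
    and diam: "finite_diameter (dist_X i) (x ` {..<n}) < 2 * real (faithful_radius i)"
    and l: "(\<Sum>k<n. l k) = 0"
  shows "(\<Sum>k<n. \<Sum>m<n. l k * l m * pullback_kernel \<psi> i (x k) (x m)) \<le> 0"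
proof (cases "n = 0")
  case False
  let ?r = "faithful_radius i"
  have d: "dist_X i (x k) (x m) < 2 * real ?r" if "k < n" "m < n" for k m
  proof -
    have "dist_X i (x k) (x m) \<le> finite_diameter (dist_X i) (x ` {..<n})"
      unfolding finite_diameter_def using that by (intro Max_ge) auto
    then show ?thesis using diam by simp
  qed
  have x0: "x 0 \<in> Y i" using x False by simp
  define g where "g k = connecting i (x 0) (x k)" for k
  have g: "g k \<in> word_ball (2 * ?r)" "x k = \<sigma> i (g k) (x 0)" if "k < n" for k
    using obtain_connecting[OF x0 _ d] x[OF that] Y_sub that False unfolding g_def by blast+
  have r: "?r > 0" using obtain_connecting[OF x0 _ d[of 0 0]] x0 Y_sub False by blast
  have ball: "word_ball n \<subseteq> F i" if "n \<le> 8 * ?r" for n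
    using faithful_radius_ball[OF r] word_ball_mono[OF that] by auto
  have gc: "g k \<in> carrier G" if "k < n" for k using g(1)[OF that] word_ball_carrier by auto
  have K: "pullback_kernel \<psi> i (x k) (x m) = \<psi> (inv (inv (g k)) \<otimes> inv (g m))" if km: "k < n" "m < n" for k m
  proof -
    have q: "g m \<otimes> inv (g k) \<in> word_ball (4 * ?r)"
      using word_ball_mult[OF g(1)[OF km(2)] word_ball_inv[OF g(1)[OF km(1)]]] by simp
    have "\<sigma> i (g m \<otimes> inv (g k)) (x k) = \<sigma> i (g m \<otimes> inv (g k)) (\<sigma> i (g k) (x 0))"
      using g(2)[OF km(1)] by simp
    also have "\<dots> = \<sigma> i (g m \<otimes> inv (g k) \<otimes> g k) (x 0)"
      using q g(1)[OF km(1)] ball[of "4 * ?r"] ball[of "2 * ?r"] by (intro act x0) auto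
    also have "g m \<otimes> inv (g k) \<otimes> g k = g m" using gc km by (simp add: m_assoc)
    finally have "x m = \<sigma> i (g m \<otimes> inv (g k)) (x k)" using g(2)[OF km(2)] by simp
    then have "connecting i (x k) (x m) = g m \<otimes> inv (g k)"
      using connecting_eq[OF x[OF km(1)] r q] by simp
    then have "pullback_kernel \<psi> i (x k) (x m) = \<psi> (g m \<otimes> inv (g k))"
      using d[OF km] by (simp add: pullback_kernel_def)
    also have "\<dots> = \<psi> (inv (g m \<otimes> inv (g k)))" using gc km by (intro sym) auto
    also have "inv (g m \<otimes> inv (g k)) = inv (inv (g k)) \<otimes> inv (g m)"
      using gc km by (simp add: inv_mult_group)
    finally show ?thesis .
  qed
  have "(\<Sum>k<n. \<Sum>m<n. l k * l m * pullback_kernel \<psi> i (x k) (x m)) =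
      (\<Sum>k<n. \<Sum>m<n. l k * l m * \<psi> (inv (inv (g k)) \<otimes> inv (g m)))"
    using K by (intro sum.cong) auto
  also have "\<dots> \<le> 0" using gc l by (intro neg) auto
  finally show ?thesis .
qed auto

text \<open>It suffices to discard the bad points: near a good point the kernel is computed in the group,
  and far pairs only have to respect the growth bounds.\<close>

lemma a_T_menable_imp_embeddable:
  assumes inf: "infinite (carrier G)" and aT: "a_T_menable G"
  shows "asymp_coarsely_embeddable Y dist_X"
proof -
  from aT[unfolded a_T_menable_def] obtain \<psi>
    where \<psi>: "\<forall>C. finite {g \<in> carrier G. \<bar>\<psi> g\<bar> \<le> C}" "\<psi> \<one> = 0" "\<forall>g\<in>carrier G. \<psi> g = \<psi> (inv g)"
      "\<forall>(n::nat) g (l :: nat \<Rightarrow> real). (\<forall>i<n. g i \<in> carrier G) \<and> (\<Sum>i<n. l i) = 0 \<longrightarrow>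
        (\<Sum>i<n. \<Sum>j<n. l i * l j * \<psi> (inv (g i) \<otimes> g j)) \<le> 0"
    by (elim exE conjE)
  have proper: "finite {g \<in> carrier G. \<bar>\<psi> g\<bar> \<le> C}" for C using \<psi>(1) by blast
  have sym: "\<psi> g = \<psi> (inv g)" if "g \<in> carrier G" for g using \<psi>(3) that by blast
  have neg: "(\<Sum>i<n. \<Sum>j<n. l i * l j * \<psi> (inv (g i) \<otimes> g j)) \<le> 0"
    if "\<And>i. i < n \<Longrightarrow> g i \<in> carrier G" "(\<Sum>i<n. l i) = 0" for n :: nat and g and l :: "nat \<Rightarrow> real"
    using \<psi>(4) that by blast
  note one = \<psi>(2)
  have nonneg: "0 \<le> \<psi> g" if "g \<in> carrier G" for g
    using negative_type_nonneg[of \<psi>, OF one sym neg that] by blast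
  let ?\<rho>\<^sub>2 = "\<lambda>t. lower_growth \<psi> t + upper_growth \<psi> t"
  have lower_lim: "filterlim (lower_growth \<psi>) at_top at_top"
    using lower_growth_at_top[of \<psi>, OF inf nonneg proper] by blast
  have lower_mono: "mono (lower_growth \<psi>)" using lower_growth_mono[of \<psi>, OF inf nonneg] by blast
  have upper_mono: "mono_on {0..} (upper_growth \<psi>)" using upper_growth_mono_on[of \<psi>, OF inf nonneg] by blast
  show ?thesis
    unfolding asymp_coarsely_embeddable_def
  proof (rule exI[of _ "pullback_kernel \<psi>"], rule exI[of _ "lower_growth \<psi>"], rule exI[of _ ?\<rho>\<^sub>2],
      rule exI[of _ "\<lambda>i. real (faithful_radius i)"], intro conjI)
    show "\<forall>i. \<forall>x\<in>Y i. \<forall>y\<in>Y i. pullback_kernel \<psi> i x y = pullback_kernel \<psi> i y x"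
      using kernel_sym[of \<psi>, OF sym] by simp
    show "mono_on {0..} (lower_growth \<psi>)" using lower_mono by (auto intro: mono_onI dest: monoD)
    show "filterlim (lower_growth \<psi>) at_top at_top" by (rule lower_lim)
    show "mono_on {0..} ?\<rho>\<^sub>2"
    proof (rule mono_onI)
      fix s t :: real assume "s \<in> {0..}" "t \<in> {0..}" "s \<le> t"
      then show "?\<rho>\<^sub>2 s \<le> ?\<rho>\<^sub>2 t"
        by (intro add_mono monoD[OF lower_mono] mono_onD[OF upper_mono])
    qed
    show "filterlim ?\<rho>\<^sub>2 at_top at_top"
    proof (rule filterlim_at_top_mono[OF lower_lim])
      show "\<forall>\<^sub>F t in at_top. lower_growth \<psi> t \<le> ?\<rho>\<^sub>2 t"
        using eventually_ge_at_top[of 0]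
        by eventually_elim (use upper_growth_nonneg[of \<psi>, OF inf nonneg] in simp)
    qed
    show "\<forall>i. 0 \<le> real (faithful_radius i)" by simp
    show "filterlim (\<lambda>i. real (faithful_radius i)) at_top sequentially"
      by (rule faithful_radius_at_top)
    show "\<forall>x. (\<forall>\<^sub>F i in sequentially. x i \<in> Y i) \<longrightarrow> (\<lambda>i. pullback_kernel \<psi> i (x i) (x i)) \<longlonglongrightarrow> 0"
    proof (intro allI impI)
      fix x :: "nat \<Rightarrow> 'x" assume "\<forall>\<^sub>F i in sequentially. x i \<in> Y i"
      moreover have "\<forall>\<^sub>F i in sequentially. 0 < real (faithful_radius i)"
        using faithful_radius_at_top unfolding filterlim_at_top_dense by blast
      ultimately have "\<forall>\<^sub>F i in sequentially. pullback_kernel \<psi> i (x i) (x i) = 0"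
        by eventually_elim (use kernel_diagonal one in auto)
      then show "(\<lambda>i. pullback_kernel \<psi> i (x i) (x i)) \<longlonglongrightarrow> 0" by (rule tendsto_eventually)
    qed
    show "\<forall>i. \<forall>x\<in>Y i. \<forall>y\<in>Y i. lower_growth \<psi> (dist_X i x y) \<le> pullback_kernel \<psi> i x y \<and>
        pullback_kernel \<psi> i x y \<le> ?\<rho>\<^sub>2 (dist_X i x y)"
      using kernel_bounds[of \<psi>, OF inf nonneg] by simp
    show "\<forall>i (n::nat) x l. (\<forall>k<n. x k \<in> Y i) \<and>
        finite_diameter (dist_X i) (x ` {..<n}) < 2 * real (faithful_radius i) \<and>
        (\<Sum>k<n. l k) = (0::real) \<longrightarrow>
        (\<Sum>k<n. \<Sum>m<n. l k * l m * pullback_kernel \<psi> i (x k) (x m)) \<le> 0"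
      by (intro allI impI kernel_negative_type[of \<psi>, OF sym neg]) auto
  qed
qed

end

section \<open>Averaging kernels over the approximation\<close>

context good_approximation
begin

definition null_family :: "(nat \<Rightarrow> 'x set) \<Rightarrow> bool" where
  "null_family N \<longleftrightarrow> (\<forall>i. N i \<subseteq> X i) \<and> (\<lambda>i. real (card (N i)) / real (card (X i))) \<longlonglongrightarrow> 0"

lemma null_family_subset:
  assumes M: "null_family M" and sub: "\<And>i. N i \<subseteq> M i"
  shows "null_family N"
  unfolding null_family_def
proof
  show "\<forall>i. N i \<subseteq> X i" using M sub unfolding null_family_def by blast
  have fin: "finite (M i)" for i using M X_finite finite_subset unfolding null_family_def by blast
  have le: "real (card (N i)) / real (card (X i)) \<le> real (card (M i)) / real (card (X i))" for i
    using card_mono[OF fin sub] by (intro divide_right_mono) auto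
  have "(\<lambda>i. real (card (M i)) / real (card (X i))) \<longlonglongrightarrow> 0" using M by (simp add: null_family_def)
  then show "(\<lambda>i. real (card (N i)) / real (card (X i))) \<longlonglongrightarrow> 0"
    by (rule real_tendsto_sandwich[OF _ _ tendsto_const, rotated 2])
      (use le in \<open>auto intro!: always_eventually\<close>)
qed

lemma null_family_empty: "null_family (\<lambda>i. {})"
  by (simp add: null_family_def)

lemma null_family_Un:
  assumes M: "null_family M" and N: "null_family N"
  shows "null_family (\<lambda>i. M i \<union> N i)"
  unfolding null_family_def
proof
  show "\<forall>i. M i \<union> N i \<subseteq> X i" using M N unfolding null_family_def by blast
  have "(\<lambda>i. real (card (M i)) / real (card (X i)) + real (card (N i)) / real (card (X i))) \<longlonglongrightarrow> 0 + 0"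
    using M N unfolding null_family_def by (intro tendsto_add) auto
  then have lim: "(\<lambda>i. (real (card (M i)) + real (card (N i))) / real (card (X i))) \<longlonglongrightarrow> 0"
    by (simp add: add_divide_distrib)
  have "real (card (M i \<union> N i)) \<le> real (card (M i)) + real (card (N i))" for i
    using card_Un_le[of "M i" "N i"] by linarith
  then show "(\<lambda>i. real (card (M i \<union> N i)) / real (card (X i))) \<longlonglongrightarrow> 0"
    by (intro real_tendsto_sandwich[OF _ _ tendsto_const lim])
      (auto intro!: always_eventually divide_right_mono)
qed

lemma null_family_UN:
  fixes N :: "nat \<Rightarrow> nat \<Rightarrow> 'x set"
  assumes "\<And>k. k < n \<Longrightarrow> null_family (N k)"
  shows "null_family (\<lambda>i. \<Union>k<n. N k i)"
  using assms
proof (induction n)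
  case 0
  then show ?case using null_family_empty by simp
next
  case (Suc n)
  then have "null_family (\<lambda>i. N n i \<union> (\<Union>k<n. N k i))" by (intro null_family_Un) auto
  then show ?case by (simp add: lessThan_Suc)
qed

text \<open>Permutations preserve cardinality, so bad sets stay null when pulled back along a group
  element.\<close>

lemma null_family_vimage:
  assumes N: "null_family N" and g: "g \<in> carrier G"
  shows "null_family (\<lambda>i. {x \<in> X i. \<sigma> i g x \<in> N i})"
proof -
  have "card {x \<in> X i. \<sigma> i g x \<in> N i} \<le> card (N i)" for i
  proof (rule card_inj_on_le[of "\<sigma> i g"])
    show "inj_on (\<sigma> i g) {x \<in> X i. \<sigma> i g x \<in> N i}"
      using permutes_inj[OF perm[OF g]] inj_on_subset by blast
    show "finite (N i)" using N X_finite finite_subset unfolding null_family_def by blast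
  qed auto
  then have le: "real (card {x \<in> X i. \<sigma> i g x \<in> N i}) / real (card (X i)) \<le> real (card (N i)) / real (card (X i))" for i
    by (intro divide_right_mono) auto
  have "(\<lambda>i. real (card (N i)) / real (card (X i))) \<longlonglongrightarrow> 0" using N by (simp add: null_family_def)
  then have "(\<lambda>i. real (card {x \<in> X i. \<sigma> i g x \<in> N i}) / real (card (X i))) \<longlonglongrightarrow> 0"
    by (rule real_tendsto_sandwich[OF _ _ tendsto_const, rotated 2])
      (use le in \<open>auto intro!: always_eventually\<close>)
  then show ?thesis by (simp add: null_family_def)
qed

lemma full_ratio:
  assumes N: "null_family (\<lambda>i. X i - A i)" and A: "\<And>i. A i \<subseteq> X i"
  shows "(\<lambda>i. real (card (A i)) / real (card (X i))) \<longlonglongrightarrow> 1"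
proof -
  have "real (card (A i)) / real (card (X i)) = 1 - real (card (X i - A i)) / real (card (X i))" for i
  proof -
    have "card (X i - A i) = card (X i) - card (A i)"
      using A X_finite by (intro card_Diff_subset) (auto intro: finite_subset)
    moreover have "card (A i) \<le> card (X i)" using A X_finite by (intro card_mono)
    ultimately show ?thesis using card_X_pos[of i] by (simp add: of_nat_diff field_simps)
  qed
  moreover have "(\<lambda>i. 1 - real (card (X i - A i)) / real (card (X i))) \<longlonglongrightarrow> 1 - 0"
    using N unfolding null_family_def by (intro tendsto_intros) auto
  ultimately show ?thesis by simp
qed

end

locale embedded_approximation = good_approximation G S X \<sigma> F Y
  for G :: "('a, 'm) monoid_scheme" (structure) and S and X :: "nat \<Rightarrow> 'x set" and \<sigma> and F and Y +
  fixes Z :: "nat \<Rightarrow> 'x set" and K :: "nat \<Rightarrow> 'x \<Rightarrow> 'x \<Rightarrow> real"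
    and \<rho>\<^sub>1 \<rho>\<^sub>2 :: "real \<Rightarrow> real" and R :: "nat \<Rightarrow> real"
  assumes Z_null: "null_family Z"
    and lower_at_top: "filterlim \<rho>\<^sub>1 at_top at_top"
    and R_at_top: "filterlim R at_top sequentially"
    and diagonal: "\<And>x. \<forall>\<^sub>F i in sequentially. x i \<in> X i - Z i \<Longrightarrow> (\<lambda>i. K i (x i) (x i)) \<longlonglongrightarrow> 0"
    and bounds: "\<lbrakk>x \<in> X i - Z i; y \<in> X i - Z i\<rbrakk> \<Longrightarrow>
      \<rho>\<^sub>1 (dist_X i x y) \<le> K i x y \<and> K i x y \<le> \<rho>\<^sub>2 (dist_X i x y)"
    and negative: "\<And>i (n :: nat) x (l :: nat \<Rightarrow> real). \<lbrakk>\<And>k. k < n \<Longrightarrow> x k \<in> X i - Z i;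
      finite_diameter (dist_X i) (x ` {..<n}) < 2 * R i; (\<Sum>k<n. l k) = 0\<rbrakk> \<Longrightarrow>
      (\<Sum>k<n. \<Sum>m<n. l k * l m * K i (x k) (x m)) \<le> 0"
begin

definition usable :: "nat \<Rightarrow> 'x set" where
  "usable i = Y i - Z i"

text \<open>Both ends of the pair \<open>(y, \<sigma> g y)\<close> are required to be good and outside \<open>Z\<close>: then the distance
  of the pair is the length of \<open>g\<close>, so the kernel is bounded there in terms of \<open>g\<close> alone, whereas a
  pair at a bad point could be arbitrarily far apart. The average is still taken over all of \<open>X i\<close>,
  from which the domain differs by a null family.\<close>

definition mean_domain :: "nat \<Rightarrow> 'a \<Rightarrow> 'x set" where
  "mean_domain i g = {y \<in> usable i. \<sigma> i g y \<in> usable i}"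

definition mean :: "nat \<Rightarrow> 'a \<Rightarrow> real" where
  "mean i g = (\<Sum>y\<in>mean_domain i g. K i y (\<sigma> i g y)) / real (card (X i))"

lemma usable_subset: "usable i \<subseteq> X i"
  using Y_sub by (auto simp: usable_def)

lemma mean_domain_subset: "mean_domain i g \<subseteq> X i"
  using usable_subset by (auto simp: mean_domain_def)

lemma finite_mean_domain: "finite (mean_domain i g)"
  using mean_domain_subset X_finite finite_subset by blast

lemma bad_null: "null_family (\<lambda>i. X i - Y i)"
  using Y_full by (simp add: null_family_def)

lemma unusable_null: "null_family (\<lambda>i. X i - usable i)"
  by (rule null_family_subset[OF null_family_Un[OF bad_null Z_null]]) (auto simp: usable_def)

lemma mean_domain_null:
  assumes "g \<in> carrier G"
  shows "null_family (\<lambda>i. X i - mean_domain i g)"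
  by (rule null_family_subset[OF null_family_Un[OF unusable_null null_family_vimage[OF unusable_null assms]]])
    (use permutes_in_image[OF perm[OF assms]] in \<open>auto simp: mean_domain_def\<close>)

lemma kernel_on_mean_domain:
  assumes g: "g \<in> carrier G" and ball: "word_ball (2 * word_length g) \<subseteq> F i"
    and y: "y \<in> mean_domain i g"
  shows "dist_X i y (\<sigma> i g y) = real (word_length g)"
    "\<rho>\<^sub>1 (real (word_length g)) \<le> K i y (\<sigma> i g y)" "K i y (\<sigma> i g y) \<le> \<rho>\<^sub>2 (real (word_length g))"
proof -
  have yY: "y \<in> Y i" using y by (auto simp: mean_domain_def usable_def)
  interpret P: good_point G S "F i" "X i" "\<sigma> i" y using yY by (rule good_pointI)
  show d: "dist_X i y (\<sigma> i g y) = real (word_length g)"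
    using P.path_metric_act[OF ball] g by (simp add: word_ball_def)
  have "y \<in> X i - Z i" "\<sigma> i g y \<in> X i - Z i"
    using y usable_subset by (auto simp: mean_domain_def usable_def)
  from bounds[OF this] show "\<rho>\<^sub>1 (real (word_length g)) \<le> K i y (\<sigma> i g y)"
    "K i y (\<sigma> i g y) \<le> \<rho>\<^sub>2 (real (word_length g))" by (simp_all add: d)
qed

definition kernel_bound :: "'a \<Rightarrow> real" where
  "kernel_bound g = max \<bar>\<rho>\<^sub>1 (real (word_length g))\<bar> \<bar>\<rho>\<^sub>2 (real (word_length g))\<bar>"

lemma abs_kernel_on_mean_domain:
  assumes "g \<in> carrier G" "word_ball (2 * word_length g) \<subseteq> F i" "y \<in> mean_domain i g"
  shows "\<bar>K i y (\<sigma> i g y)\<bar> \<le> kernel_bound g"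
  using kernel_on_mean_domain[OF assms] unfolding kernel_bound_def by linarith

lemma mean_Bseq:
  assumes g: "g \<in> carrier G"
  shows "Bseq (\<lambda>i. mean i g)"
proof (rule BfunI)
  show "\<forall>\<^sub>F i in sequentially. norm (mean i g) \<le> kernel_bound g"
    using eventually_word_ball[of "2 * word_length g"]
  proof eventually_elim
    case (elim i)
    have "\<bar>\<Sum>y\<in>mean_domain i g. K i y (\<sigma> i g y)\<bar> \<le> (\<Sum>y\<in>mean_domain i g. \<bar>K i y (\<sigma> i g y)\<bar>)"
      by (rule sum_abs)
    also have "\<dots> \<le> real (card (mean_domain i g)) * kernel_bound g"
      by (rule sum_bounded_above[OF abs_kernel_on_mean_domain[OF g elim]])
    also have "\<dots> \<le> real (card (X i)) * kernel_bound g"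
      using mean_domain_subset X_finite
      by (intro mult_right_mono) (auto simp: kernel_bound_def card_mono)
    finally show ?case using card_X_pos[of i] by (simp add: mean_def field_simps)
  qed
qed

text \<open>Change of variables: replacing \<open>y\<close> by \<open>\<sigma> p x\<close> turns the pair \<open>(\<sigma> p x, \<sigma> q x)\<close> into
  \<open>(y, \<sigma> (q \<otimes> inv p) y)\<close>, and changes the range of summation only by a null family, on which the
  summands are bounded.\<close>

lemma mean_translate:
  assumes p: "p \<in> carrier G" and q: "q \<in> carrier G"
    and A: "\<And>i. A i \<subseteq> {x \<in> Y i. \<sigma> i p x \<in> usable i \<and> \<sigma> i q x \<in> usable i}"
    and null: "null_family (\<lambda>i. X i - A i)"
  shows "(\<lambda>i. (\<Sum>x\<in>A i. K i (\<sigma> i p x) (\<sigma> i q x)) / real (card (X i)) - mean i (q \<otimes> inv p)) \<longlonglongrightarrow> 0"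
proof -
  define h where "h = q \<otimes> inv p"
  have h: "h \<in> carrier G" "h \<otimes> p = q" using p q by (auto simp: h_def m_assoc)
  let ?S = "\<lambda>i. \<Sum>x\<in>A i. K i (\<sigma> i p x) (\<sigma> i q x)"
  have "\<forall>\<^sub>F i in sequentially. {p, q, h} \<subseteq> F i" using p q h by (intro eventually_in_F) auto
  then have ev: "\<forall>\<^sub>F i in sequentially. norm (?S i / real (card (X i)) - mean i h)
      \<le> real (card (X i - A i)) / real (card (X i)) * kernel_bound h"
    using eventually_word_ball[of "2 * word_length h"]
  proof eventually_elim
    case (elim i)
    let ?f = "\<lambda>y. K i y (\<sigma> i h y)" and ?B = "\<sigma> i p ` A i" and ?D = "mean_domain i h"
    have AX: "A i \<subseteq> X i" using A[of i] Y_sub by blast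
    have inj: "inj_on (\<sigma> i p) (A i)" using permutes_inj[OF perm[OF p]] inj_on_subset by blast
    have qx: "\<sigma> i h (\<sigma> i p x) = \<sigma> i q x" if "x \<in> A i" for x
      using act[of x i h p] A[of i] that elim(1) h by auto
    have BD: "?B \<subseteq> ?D" using A[of i] qx by (auto simp: mean_domain_def)
    have "?S i = sum ?f ?B"
      using inj qx by (simp add: sum.reindex)
    moreover have "sum ?f ?D = sum ?f (?D - ?B) + sum ?f ?B"
      using BD finite_mean_domain by (intro sum.subset_diff) auto
    ultimately have "\<bar>?S i - sum ?f ?D\<bar> = \<bar>sum ?f (?D - ?B)\<bar>" by simp
    also have "\<dots> \<le> (\<Sum>y\<in>?D - ?B. \<bar>?f y\<bar>)" by (rule sum_abs)
    also have "\<dots> \<le> real (card (?D - ?B)) * kernel_bound h"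
      by (rule sum_bounded_above, rule abs_kernel_on_mean_domain[OF h(1) elim(2)]) simp
    finally have le: "\<bar>?S i - sum ?f ?D\<bar> \<le> real (card (?D - ?B)) * kernel_bound h" .
    have fin: "finite ?B" using BD finite_mean_domain finite_subset by blast
    have "card (?D - ?B) \<le> card (X i - ?B)"
      using mean_domain_subset X_finite by (intro card_mono) auto
    also have "\<dots> = card (X i) - card (A i)"
      using fin BD mean_domain_subset inj by (subst card_Diff_subset) (auto simp: card_image)
    also have "\<dots> = card (X i - A i)"
      using AX X_finite finite_subset by (metis card_Diff_subset)
    finally have "real (card (?D - ?B)) * kernel_bound h \<le> real (card (X i - A i)) * kernel_bound h"
      by (intro mult_right_mono) (auto simp: kernel_bound_def)
    with le have "\<bar>?S i - sum ?f ?D\<bar> \<le> real (card (X i - A i)) * kernel_bound h" by linarith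
    then have "\<bar>(?S i - sum ?f ?D) / real (card (X i))\<bar> \<le> real (card (X i - A i)) * kernel_bound h / real (card (X i))"
      unfolding abs_divide by (simp add: divide_right_mono)
    then show ?case by (simp add: mean_def diff_divide_distrib)
  qed
  have "(\<lambda>i. real (card (X i - A i)) / real (card (X i)) * kernel_bound h) \<longlonglongrightarrow> 0 * kernel_bound h"
    using null unfolding null_family_def by (intro tendsto_intros) auto
  then show ?thesis unfolding h_def[symmetric] using Lim_null_comparison[OF ev] by simp
qed

context
  fixes r :: "nat \<Rightarrow> nat" and L :: "'a \<Rightarrow> real"
  assumes r: "strict_mono r" and L: "\<And>g. g \<in> carrier G \<Longrightarrow> (\<lambda>i. mean (r i) g) \<longlonglongrightarrow> L g"
begin

text \<open>The domain of the mean has density tending to \<open>1\<close>, so no factor is lost in the bound, even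
  where \<open>\<rho>\<^sub>1\<close> is negative.\<close>

lemma limit_lower_bound:
  assumes g: "g \<in> carrier G"
  shows "\<rho>\<^sub>1 (real (word_length g)) \<le> L g"
proof (rule tendsto_le[OF _ L[OF g]])
  have "(\<lambda>i. \<rho>\<^sub>1 (real (word_length g)) * (real (card (mean_domain i g)) / real (card (X i))))
      \<longlonglongrightarrow> \<rho>\<^sub>1 (real (word_length g)) * 1"
    using full_ratio[OF mean_domain_null[OF g] mean_domain_subset] by (intro tendsto_intros)
  from LIMSEQ_subseq_LIMSEQ[OF this r]
  show "(\<lambda>i. \<rho>\<^sub>1 (real (word_length g)) *
      (real (card (mean_domain (r i) g)) / real (card (X (r i))))) \<longlonglongrightarrow> \<rho>\<^sub>1 (real (word_length g))"
    by (simp add: o_def)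
  have "\<forall>\<^sub>F i in sequentially.
      \<rho>\<^sub>1 (real (word_length g)) * (real (card (mean_domain i g)) / real (card (X i))) \<le> mean i g"
    using eventually_word_ball[of "2 * word_length g"]
  proof eventually_elim
    case (elim i)
    have "real (card (mean_domain i g)) * \<rho>\<^sub>1 (real (word_length g)) \<le> (\<Sum>y\<in>mean_domain i g. K i y (\<sigma> i g y))"
      by (rule sum_bounded_below[OF kernel_on_mean_domain(2)[OF g elim]])
    then show ?case unfolding mean_def using card_X_pos[of i] by (simp add: field_simps)
  qed
  then show "\<forall>\<^sub>F i in sequentially.
      \<rho>\<^sub>1 (real (word_length g)) * (real (card (mean_domain (r i) g)) / real (card (X (r i)))) \<le> mean (r i) g"
    using eventually_subseq[OF r] by blast
qed auto

text \<open>The diagonal condition speaks of arbitrary sequences of points, so applied to points where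
  \<open>\<bar>K i x x\<bar>\<close> is largest it makes the diagonal tend to \<open>0\<close> uniformly.\<close>

lemma limit_one: "L \<one> = 0"
proof -
  define W where "W i = X i - Z i" for i
  have finW: "finite (W i)" for i using X_finite by (simp add: W_def)
  define x where "x i = (SOME x. x \<in> W i \<and> (\<forall>y\<in>W i. \<bar>K i y y\<bar> \<le> \<bar>K i x x\<bar>))" for i
  have x: "x i \<in> W i \<and> (\<forall>y\<in>W i. \<bar>K i y y\<bar> \<le> \<bar>K i (x i) (x i)\<bar>)" if "W i \<noteq> {}" for i
  proof -
    have "Max ((\<lambda>y. \<bar>K i y y\<bar>) ` W i) \<in> (\<lambda>y. \<bar>K i y y\<bar>) ` W i" using finW that by (intro Max_in) auto
    then obtain z where z: "z \<in> W i" "\<bar>K i z z\<bar> = Max ((\<lambda>y. \<bar>K i y y\<bar>) ` W i)" by auto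
    have "z \<in> W i \<and> (\<forall>y\<in>W i. \<bar>K i y y\<bar> \<le> \<bar>K i z z\<bar>)" using z finW by simp
    then show ?thesis unfolding x_def by (rule someI)
  qed
  have "\<forall>\<^sub>F i in sequentially. real (card (Z i)) / real (card (X i)) < 1"
    using Z_null unfolding null_family_def by (intro order_tendstoD(2)[where y = 0]) auto
  then have W_nonempty: "\<forall>\<^sub>F i in sequentially. W i \<noteq> {}"
  proof eventually_elim
    case (elim i)
    have "X i \<noteq> Z i" using elim card_X_pos[of i] by auto
    then show ?case using Z_null unfolding W_def null_family_def by blast
  qed
  then have "\<forall>\<^sub>F i in sequentially. x i \<in> X i - Z i"
    by eventually_elim (use x in \<open>auto simp: W_def\<close>)
  from diagonal[OF this] have lim: "(\<lambda>i. \<bar>K i (x i) (x i)\<bar>) \<longlonglongrightarrow> 0" by (rule tendsto_rabs_zero)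
  have "\<forall>\<^sub>F i in sequentially. {\<one>} \<subseteq> F i" by (intro eventually_in_F) auto
  with W_nonempty have "\<forall>\<^sub>F i in sequentially. norm (mean i \<one>) \<le> \<bar>K i (x i) (x i)\<bar>"
  proof eventually_elim
    case (elim i)
    let ?D = "mean_domain i \<one>"
    have fixed: "\<sigma> i \<one> y = y" if "y \<in> ?D" for y
    proof -
      interpret P: good_point G S "F i" "X i" "\<sigma> i" y
        using that by (intro good_pointI) (auto simp: mean_domain_def usable_def)
      show ?thesis using P.act_one elim by simp
    qed
    have "\<bar>K i y (\<sigma> i \<one> y)\<bar> \<le> \<bar>K i (x i) (x i)\<bar>" if y: "y \<in> ?D" for y
    proof -
      have "y \<in> W i" using y Y_sub by (auto simp: W_def mean_domain_def usable_def)
      then show ?thesis using x[OF elim(1)] fixed[OF y] by simp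
    qed
    then have "(\<Sum>y\<in>?D. \<bar>K i y (\<sigma> i \<one> y)\<bar>) \<le> real (card ?D) * \<bar>K i (x i) (x i)\<bar>"
      by (intro sum_bounded_above) blast
    also have "\<dots> \<le> real (card (X i)) * \<bar>K i (x i) (x i)\<bar>"
      using mean_domain_subset X_finite by (intro mult_right_mono) (auto simp: card_mono)
    finally have "\<bar>\<Sum>y\<in>?D. K i y (\<sigma> i \<one> y)\<bar> \<le> real (card (X i)) * \<bar>K i (x i) (x i)\<bar>"
      by (rule order_trans[OF sum_abs])
    then show ?case unfolding mean_def using card_X_pos[of i] by (simp add: field_simps)
  qed
  then have "(\<lambda>i. mean i \<one>) \<longlonglongrightarrow> 0" using lim by (rule Lim_null_comparison)
  from LIMSEQ_subseq_LIMSEQ[OF this r] have "(\<lambda>i. mean (r i) \<one>) \<longlonglongrightarrow> 0" by (simp add: o_def)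
  then show ?thesis using L[of \<one>] LIMSEQ_unique by blast
qed

text \<open>For almost every \<open>x\<close> the points \<open>\<sigma> (inv (g k)) x\<close> form a set of bounded diameter, on which the
  kernel is of negative type once \<open>R\<close> is large; averaging over \<open>x\<close> and passing to the limit
  gives the quadratic form of \<open>L\<close>.\<close>

lemma limit_negative_type:
  fixes n :: nat and l :: "nat \<Rightarrow> real"
  assumes g: "\<And>k. k < n \<Longrightarrow> g k \<in> carrier G" and l: "(\<Sum>k<n. l k) = 0"
  shows "(\<Sum>k<n. \<Sum>m<n. l k * l m * L (inv (g k) \<otimes> g m)) \<le> 0"
proof (cases "n = 0")
  case False
  define A where "A i = {x \<in> Y i. \<forall>k<n. \<sigma> i (inv (g k)) x \<in> usable i}" for i
  have "null_family (\<lambda>i. (X i - Y i) \<union>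
      (\<Union>k<n. {x \<in> X i. \<sigma> i (inv (g k)) x \<in> X i - usable i}))"
    using g by (intro null_family_Un null_family_UN null_family_vimage unusable_null bad_null) auto
  then have A_null: "null_family (\<lambda>i. X i - A i)"
  proof (rule null_family_subset)
    fix i
    have "\<sigma> i (inv (g k)) x \<in> X i" if "x \<in> X i" "k < n" for x k
      using g that by (simp add: permutes_in_image[OF perm])
    then show "X i - A i \<subseteq> (X i - Y i) \<union> (\<Union>k<n. {x \<in> X i. \<sigma> i (inv (g k)) x \<in> X i - usable i})"
      by (auto simp: A_def)
  qed
  define \<Phi> where "\<Phi> i k m =
    (\<Sum>x\<in>A i. K i (\<sigma> i (inv (g m)) x) (\<sigma> i (inv (g k)) x)) / real (card (X i))" for i k m
  have lim: "(\<lambda>i. \<Phi> (r i) k m) \<longlonglongrightarrow> L (inv (g k) \<otimes> g m)" if km: "k < n" "m < n" for k m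
  proof -
    have "(\<lambda>i. \<Phi> i k m - mean i (inv (g k) \<otimes> inv (inv (g m)))) \<longlonglongrightarrow> 0"
      unfolding \<Phi>_def using g km by (intro mean_translate A_null) (auto simp: A_def)
    then have "(\<lambda>i. \<Phi> i k m - mean i (inv (g k) \<otimes> g m)) \<longlonglongrightarrow> 0" using g km by simp
    from LIMSEQ_subseq_LIMSEQ[OF this r]
    have "(\<lambda>i. \<Phi> (r i) k m - mean (r i) (inv (g k) \<otimes> g m)) \<longlonglongrightarrow> 0" by (simp add: o_def)
    from tendsto_add[OF this L[of "inv (g k) \<otimes> g m"]] show ?thesis using g km by simp
  qed
  define M where "M = Max ((\<lambda>(k, m). word_length (inv (g k) \<otimes> g m)) ` ({..<n} \<times> {..<n}))"
  have M: "word_length (inv (g k) \<otimes> g m) \<le> M" if "k < n" "m < n" for k m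
    unfolding M_def using that by (intro Max_ge) auto
  let ?T = "\<Union>k<n. \<Union>m<n. {inv (g k), inv (g m) \<otimes> g k}"
  have "\<forall>\<^sub>F i in sequentially. ?T \<subseteq> F i" using g by (intro eventually_in_F) auto
  moreover have "\<forall>\<^sub>F i in sequentially. real M < 2 * R i"
  proof -
    have "\<forall>\<^sub>F i in sequentially. real M / 2 < R i" using R_at_top unfolding filterlim_at_top_dense by blast
    then show ?thesis by eventually_elim simp
  qed
  ultimately have "\<forall>\<^sub>F i in sequentially. (\<Sum>k<n. \<Sum>m<n. l k * l m * \<Phi> i k m) \<le> 0"
    using eventually_word_ball[of "2 * M"]
  proof eventually_elim
    case (elim i)
    have point: "(\<Sum>k<n. \<Sum>m<n. l k * l m * K i (\<sigma> i (inv (g m)) x) (\<sigma> i (inv (g k)) x)) \<le> 0"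
      if x: "x \<in> A i" for x
    proof -
      define z where "z k = \<sigma> i (inv (g k)) x" for k
      have zU: "z k \<in> usable i" if "k < n" for k using x that by (auto simp: A_def z_def)
      have zW: "z k \<in> X i - Z i" if "k < n" for k
        using zU[OF that] usable_subset by (auto simp: usable_def)
      have dist: "dist_X i (z k) (z m) \<le> real M" if km: "k < n" "m < n" for k m
      proof -
        let ?h = "inv (g m) \<otimes> g k"
        have hF: "?h \<in> F i" "inv (g k) \<in> F i" using elim(1) km by blast+
        have hc: "?h \<in> carrier G" using g km by auto
        have "\<sigma> i ?h (z k) = \<sigma> i (?h \<otimes> inv (g k)) x"
          unfolding z_def using x hF by (intro act) (auto simp: A_def)
        also have "?h \<otimes> inv (g k) = inv (g m)" using g km by (simp add: m_assoc)
        finally have h: "\<sigma> i ?h (z k) = z m" by (simp add: z_def)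
        have "word_ball (2 * word_length ?h) \<subseteq> F i"
          using elim(3) word_ball_mono[of "2 * word_length ?h" "2 * M"] M[OF km(2,1)] by auto
        moreover have "z k \<in> mean_domain i ?h" using zU km h by (simp add: mean_domain_def)
        ultimately have "dist_X i (z k) (\<sigma> i ?h (z k)) = real (word_length ?h)"
          by (rule kernel_on_mean_domain(1)[OF hc])
        then show ?thesis using h M[OF km(2,1)] by simp
      qed
      have "finite_diameter (dist_X i) (z ` {..<n}) \<le> real M"
        unfolding finite_diameter_def using dist False by (intro Max.boundedI) auto
      then have "(\<Sum>k<n. \<Sum>m<n. l k * l m * K i (z k) (z m)) \<le> 0"
        using zW elim(2) l by (intro negative) auto
      also have "(\<Sum>k<n. \<Sum>m<n. l k * l m * K i (z k) (z m)) = (\<Sum>k<n. \<Sum>m<n. l k * l m * K i (z m) (z k))"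
        by (subst sum.swap) (simp add: mult.commute)
      finally show ?thesis by (simp add: z_def)
    qed
    have "(\<Sum>k<n. \<Sum>m<n. l k * l m * \<Phi> i k m) =
      (\<Sum>x\<in>A i. \<Sum>k<n. \<Sum>m<n. l k * l m * K i (\<sigma> i (inv (g m)) x) (\<sigma> i (inv (g k)) x)) / real (card (X i))"
    proof -
      have "(\<Sum>k<n. \<Sum>m<n. l k * l m * \<Phi> i k m) =
        (\<Sum>k<n. \<Sum>m<n. \<Sum>x\<in>A i. l k * l m * K i (\<sigma> i (inv (g m)) x) (\<sigma> i (inv (g k)) x)) / real (card (X i))"
        by (simp add: \<Phi>_def sum_distrib_left sum_divide_distrib)
      also have "(\<Sum>k<n. \<Sum>m<n. \<Sum>x\<in>A i. l k * l m * K i (\<sigma> i (inv (g m)) x) (\<sigma> i (inv (g k)) x)) =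
        (\<Sum>k<n. \<Sum>x\<in>A i. \<Sum>m<n. l k * l m * K i (\<sigma> i (inv (g m)) x) (\<sigma> i (inv (g k)) x))"
        by (intro sum.cong refl sum.swap)
      also have "\<dots> = (\<Sum>x\<in>A i. \<Sum>k<n. \<Sum>m<n. l k * l m * K i (\<sigma> i (inv (g m)) x) (\<sigma> i (inv (g k)) x))"
        by (rule sum.swap)
      finally show ?thesis .
    qed
    also have "\<dots> \<le> 0" by (rule divide_nonpos_nonneg[OF sum_nonpos[OF point]]) auto
    finally show ?case .
  qed
  then have "\<forall>\<^sub>F i in sequentially. (\<Sum>k<n. \<Sum>m<n. l k * l m * \<Phi> (r i) k m) \<le> 0"
    using eventually_subseq[OF r] by blast
  moreover have "(\<lambda>i. \<Sum>k<n. \<Sum>m<n. l k * l m * \<Phi> (r i) k m) \<longlonglongrightarrow>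
      (\<Sum>k<n. \<Sum>m<n. l k * l m * L (inv (g k) \<otimes> g m))"
    by (intro tendsto_sum tendsto_mult tendsto_const lim) auto
  ultimately show ?thesis by (intro tendsto_upperbound) auto
qed auto

end

lemma convergent_means:
  obtains r L where "strict_mono (r :: nat \<Rightarrow> nat)" "\<And>g. g \<in> carrier G \<Longrightarrow> (\<lambda>i. mean (r i) g) \<longlonglongrightarrow> L g"
proof -
  have "\<exists>C>0. \<forall>i. norm (mean i g) \<le> C" if "g \<in> carrier G" for g
    using mean_Bseq[OF that] by (auto simp: Bseq_def)
  then obtain C where C: "\<And>g. g \<in> carrier G \<Longrightarrow> C g > 0 \<and> (\<forall>i. norm (mean i g) \<le> C g)" by metis
  have count: "countable (carrier G)"
    unfolding F_cover[symmetric] using F_finite by (intro countable_UN) (auto intro: countable_finite)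
  \<comment> \<open>The means are bounded for each \<open>g\<close> separately; dividing by the bound makes them uniformly bounded.\<close>
  have "norm (mean i g / C g) \<le> 1" if "g \<in> carrier G" for i g
    using C[OF that] by (simp add: norm_divide)
  from function_convergent_subsequence[of "carrier G" "\<lambda>i g. mean i g / C g" 1, OF count this] obtain r where r: "strict_mono (r :: nat \<Rightarrow> nat)"
    and conv: "\<And>g. g \<in> carrier G \<Longrightarrow> \<exists>c. (\<lambda>i. mean (r i) g / C g) \<longlonglongrightarrow> c" by blast
  have "\<exists>c. (\<lambda>i. mean (r i) g) \<longlonglongrightarrow> c" if g: "g \<in> carrier G" for g
  proof -
    obtain c where "(\<lambda>i. mean (r i) g / C g) \<longlonglongrightarrow> c" using conv g by blast
    then have "(\<lambda>i. mean (r i) g / C g * C g) \<longlonglongrightarrow> c * C g" by (intro tendsto_intros)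
    moreover have "C g \<noteq> 0" using C[OF g] by auto
    ultimately show ?thesis by auto
  qed
  then obtain L where "\<And>g. g \<in> carrier G \<Longrightarrow> (\<lambda>i. mean (r i) g) \<longlonglongrightarrow> L g" by metis
  with r that show ?thesis by blast
qed

text \<open>Symmetry of a limit \<open>L\<close> of means is enforced rather than proved: \<open>g \<mapsto> L g + L (inv g)\<close> is
  symmetric, and it is of negative type because inverting the arguments of \<open>L\<close> only exchanges the
  two indices of the quadratic form.\<close>

lemma embeddable_imp_a_T_menable: "a_T_menable G"
proof -
  obtain r L where r: "strict_mono r" and L: "\<And>g. g \<in> carrier G \<Longrightarrow> (\<lambda>i. mean (r i) g) \<longlonglongrightarrow> L g"
    using convergent_means by blast
  let ?\<psi> = "\<lambda>g. L g + L (inv g)"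
  \<comment> \<open>Properness of the sum needs only one large summand once the other is bounded below.\<close>
  have "\<exists>c. \<forall>g\<in>carrier G. c \<le> L g"
  proof -
    obtain T where T: "\<And>t. T \<le> t \<Longrightarrow> 0 \<le> \<rho>\<^sub>1 t"
      using lower_at_top by (auto simp: filterlim_at_top eventually_at_top_linorder)
    define c where "c = Min (insert 0 (L ` word_ball (nat \<lceil>T\<rceil>)))"
    have "c \<le> L g" if g: "g \<in> carrier G" for g
    proof (cases "g \<in> word_ball (nat \<lceil>T\<rceil>)")
      case True
      then show ?thesis unfolding c_def using finite_word_ball by (intro Min_le) auto
    next
      case False
      then have "T \<le> real (word_length g)" using g by (auto simp: word_ball_def) linarith
      then have "0 \<le> L g" using T limit_lower_bound[OF r L g] by (meson order_trans)
      moreover have "c \<le> 0" unfolding c_def using finite_word_ball by (intro Min_le) auto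
      ultimately show ?thesis by simp
    qed
    then show ?thesis by blast
  qed
  then obtain c where c: "\<And>g. g \<in> carrier G \<Longrightarrow> c \<le> L g" by blast
  show ?thesis
    unfolding a_T_menable_def
  proof (intro exI[of _ ?\<psi>] conjI allI ballI impI)
    fix C
    obtain T where T: "\<And>t. T \<le> t \<Longrightarrow> C - c + 1 \<le> \<rho>\<^sub>1 t"
      using lower_at_top by (auto simp: filterlim_at_top eventually_at_top_linorder)
    have "{g \<in> carrier G. \<bar>?\<psi> g\<bar> \<le> C} \<subseteq> word_ball (nat \<lceil>T\<rceil>)"
    proof
      fix g assume g: "g \<in> {g \<in> carrier G. \<bar>?\<psi> g\<bar> \<le> C}"
      then have gc: "g \<in> carrier G" by simp
      have "L g \<le> C - c" using g c[of "inv g"] by (auto simp: abs_le_iff)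
      then have "\<rho>\<^sub>1 (real (word_length g)) \<le> C - c" using limit_lower_bound[OF r L gc] by linarith
      then have "real (word_length g) < T" using T[of "real (word_length g)"] by linarith
      then show "g \<in> word_ball (nat \<lceil>T\<rceil>)" using gc by (auto simp: word_ball_def) linarith
    qed
    then show "finite {g \<in> carrier G. \<bar>?\<psi> g\<bar> \<le> C}" using finite_word_ball finite_subset by blast
  next
    show "?\<psi> \<one> = 0" using limit_one[OF r L] by simp
  next
    fix g assume "g \<in> carrier G"
    then show "?\<psi> g = ?\<psi> (inv g)" by simp
  next
    fix n :: nat and g and l :: "nat \<Rightarrow> real"
    assume gl: "(\<forall>i<n. g i \<in> carrier G) \<and> (\<Sum>i<n. l i) = 0"
    have neg: "(\<Sum>i<n. \<Sum>j<n. l i * l j * L (inv (g i) \<otimes> g j)) \<le> 0"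
      using gl by (intro limit_negative_type[OF r L]) auto
    have "(\<Sum>i<n. \<Sum>j<n. l i * l j * L (inv (inv (g i) \<otimes> g j))) =
        (\<Sum>i<n. \<Sum>j<n. l i * l j * L (inv (g j) \<otimes> g i))"
      using gl by (intro sum.cong refl) (simp add: inv_mult_group)
    also have "\<dots> = (\<Sum>i<n. \<Sum>j<n. l i * l j * L (inv (g i) \<otimes> g j))"
      by (subst sum.swap) (simp add: mult.commute)
    finally show "(\<Sum>i<n. \<Sum>j<n. l i * l j * ?\<psi> (inv (g i) \<otimes> g j)) \<le> 0"
      using neg by (simp add: distrib_left sum.distrib)
  qed
qed

end

section \<open>The equivalence\<close>

text \<open>Taking all good points at once gives a canonical \<open>Y i\<close>; it contains any set witnessing that
  \<open>\<sigma> i\<close> is an injective almost action.\<close>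

lemma sofic_approximation_imp_good_approximation:
  assumes "group G" and "finite S" and "S \<subseteq> carrier G" and "generate G S = carrier G"
    and "sofic_approximation G X \<sigma>" and conn: "\<And>i. graph_connected S (X i) (\<sigma> i)"
  obtains F Y where "good_approximation G S X \<sigma> F Y"
proof -
  interpret generated_group G S
    using assms(1-4) by (simp add: generated_group_def generated_group_axioms_def)
  obtain F \<epsilon> where F: "incseq F" "\<And>i. finite (F i)" "(\<Union>i. F i) = carrier G"
    and \<epsilon>: "\<epsilon> \<longlonglongrightarrow> 0" and act: "\<And>i. injective_almost_action G (F i) (\<epsilon> i) (X i) (\<sigma> i)"
    using assms(5) unfolding sofic_approximation_def by blast
  note act = act[unfolded injective_almost_action_def]
  have X: "finite (X i)" "X i \<noteq> {}" and perm: "\<forall>g\<in>carrier G. \<sigma> i g permutes X i" for i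
    using act[of i] by simp_all
  define Y where "Y i = {y \<in> X i. (\<forall>g\<in>F i. \<forall>h\<in>F i. \<sigma> i g (\<sigma> i h y) = \<sigma> i (g \<otimes>\<^bsub>G\<^esub> h) y) \<and>
      (\<forall>g\<in>F i - {\<one>\<^bsub>G\<^esub>}. \<sigma> i g y \<noteq> y)}" for i
  have Y: "Y i \<subseteq> X i" for i by (auto simp: Y_def)
  have card_Y: "(1 - \<epsilon> i) * real (card (X i)) \<le> real (card (Y i))" for i
  proof -
    obtain Y' where Y': "Y' \<subseteq> X i" "real (card Y') \<ge> (1 - \<epsilon> i) * real (card (X i))"
      "\<forall>g\<in>F i. \<forall>h\<in>F i. \<forall>y\<in>Y'. \<sigma> i g (\<sigma> i h y) = \<sigma> i (g \<otimes>\<^bsub>G\<^esub> h) y"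
      "\<forall>g\<in>F i - {\<one>\<^bsub>G\<^esub>}. \<forall>y\<in>Y'. \<sigma> i g y \<noteq> y"
      using act[of i] by (elim conjE exE)
    have "Y' \<subseteq> Y i" unfolding Y_def using Y' by blast
    then have "card Y' \<le> card (Y i)" by (intro card_mono finite_subset[OF Y X(1)])
    then show ?thesis using Y'(2) by linarith
  qed
  have le: "real (card (X i - Y i)) / real (card (X i)) \<le> \<epsilon> i" for i
  proof -
    have "card (X i - Y i) = card (X i) - card (Y i)"
      using Y[of i] X(1)[of i] by (intro card_Diff_subset) (auto intro: finite_subset)
    moreover have "card (Y i) \<le> card (X i)" using Y[of i] X(1)[of i] by (intro card_mono)
    moreover have "card (X i) > 0" using X[of i] by (simp add: card_gt_0_iff)
    ultimately show ?thesis using card_Y[of i] by (simp add: of_nat_diff field_simps)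
  qed
  have "(\<lambda>i. real (card (X i - Y i)) / real (card (X i))) \<longlonglongrightarrow> 0"
    by (rule real_tendsto_sandwich[OF _ _ tendsto_const \<epsilon>]) (use le in auto)
  then have "good_approximation G S X \<sigma> F Y"
  proof unfold_locales
    show "\<sigma> i g permutes X i" if "g \<in> carrier G" for i g using perm that by blast
    show "\<sigma> i g (\<sigma> i h y) = \<sigma> i (g \<otimes>\<^bsub>G\<^esub> h) y" if "y \<in> Y i" "g \<in> F i" "h \<in> F i" for i g h y
      using that by (simp add: Y_def)
    show "\<sigma> i g y \<noteq> y" if "y \<in> Y i" "g \<in> F i" "g \<noteq> \<one>\<^bsub>G\<^esub>" for i g y
      using that by (simp add: Y_def)
  qed (use F X Y conn in simp_all)
  with that show ?thesis .
qed

theorem theoremD: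
  fixes \<Gamma> :: "('g, 'm) monoid_scheme"
    and S :: "'g set"
    and X :: "nat \<Rightarrow> 'x set"
    and \<sigma> :: "nat \<Rightarrow> 'g \<Rightarrow> 'x \<Rightarrow> 'x"
  assumes "group \<Gamma>"
    and "infinite (carrier \<Gamma>)"
    and "finite S" and "S \<subseteq> carrier \<Gamma>" and "generate \<Gamma> S = carrier \<Gamma>"
    and "sofic \<Gamma>"
    and "sofic_approximation \<Gamma> X \<sigma>"
    and "\<And>i. graph_connected S (X i) (\<sigma> i)"
  shows "a_T_menable \<Gamma> \<longleftrightarrow>
    (\<exists>Z. (\<forall>i. Z i \<subseteq> X i) \<and>
         (\<lambda>i. real (card (Z i)) / real (card (X i))) \<longlonglongrightarrow> 0 \<and>
         asymp_coarsely_embeddable (\<lambda>i. X i - Z i) (\<lambda>i. path_metric S (X i) (\<sigma> i)))"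
proof -
  obtain F Y where "good_approximation \<Gamma> S X \<sigma> F Y"
    by (rule sofic_approximation_imp_good_approximation[OF assms(1,3-5,7,8)])
  then interpret good_approximation \<Gamma> S X \<sigma> F Y .
  show ?thesis
  proof
    assume "a_T_menable \<Gamma>"
    then have emb: "asymp_coarsely_embeddable Y dist_X" by (rule a_T_menable_imp_embeddable[OF assms(2)])
    have Y: "(\<lambda>i. X i - (X i - Y i)) = Y" using Y_sub by (simp add: double_diff)
    show "\<exists>Z. (\<forall>i. Z i \<subseteq> X i) \<and>
         (\<lambda>i. real (card (Z i)) / real (card (X i))) \<longlonglongrightarrow> 0 \<and>
         asymp_coarsely_embeddable (\<lambda>i. X i - Z i) dist_X"
    proof (intro exI[of _ "\<lambda>i. X i - Y i"] conjI)
      show "asymp_coarsely_embeddable (\<lambda>i. X i - (X i - Y i)) dist_X" unfolding Y by (rule emb)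
    qed (use Y_full in simp_all)
  next
    assume "\<exists>Z. (\<forall>i. Z i \<subseteq> X i) \<and>
         (\<lambda>i. real (card (Z i)) / real (card (X i))) \<longlonglongrightarrow> 0 \<and>
         asymp_coarsely_embeddable (\<lambda>i. X i - Z i) dist_X"
    then obtain Z where Z: "null_family Z" and emb: "asymp_coarsely_embeddable (\<lambda>i. X i - Z i) dist_X"
      unfolding null_family_def by blast
    from emb[unfolded asymp_coarsely_embeddable_def] obtain K \<rho>\<^sub>1 \<rho>\<^sub>2 R where
      lower: "filterlim \<rho>\<^sub>1 at_top at_top" and R: "filterlim R at_top sequentially"
      and diag: "\<forall>x. (\<forall>\<^sub>F i in sequentially. x i \<in> X i - Z i) \<longrightarrow> (\<lambda>i. K i (x i) (x i)) \<longlonglongrightarrow> 0"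
      and bounds: "\<forall>i. \<forall>x\<in>X i - Z i. \<forall>y\<in>X i - Z i. \<rho>\<^sub>1 (dist_X i x y) \<le> K i x y \<and> K i x y \<le> \<rho>\<^sub>2 (dist_X i x y)"
      and neg: "\<forall>i (n :: nat) x (l :: nat \<Rightarrow> real).
           (\<forall>k<n. x k \<in> X i - Z i) \<and> finite_diameter (dist_X i) (x ` {..<n}) < 2 * R i \<and>
           (\<Sum>k<n. l k) = 0 \<longrightarrow>
           (\<Sum>k<n. \<Sum>m<n. l k * l m * K i (x k) (x m)) \<le> 0"
      by (elim exE conjE)
    interpret embedded_approximation \<Gamma> S X \<sigma> F Y Z K \<rho>\<^sub>1 \<rho>\<^sub>2 R
    proof
      show "null_family Z" by (rule Z)
      show "filterlim \<rho>\<^sub>1 at_top at_top" by (rule lower)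
      show "filterlim R at_top sequentially" by (rule R)
    next
      fix x assume "\<forall>\<^sub>F i in sequentially. x i \<in> X i - Z i"
      then show "(\<lambda>i. K i (x i) (x i)) \<longlonglongrightarrow> 0" by (rule diag[rule_format])
    next
      fix x y i assume "x \<in> X i - Z i" "y \<in> X i - Z i"
      then show "\<rho>\<^sub>1 (dist_X i x y) \<le> K i x y \<and> K i x y \<le> \<rho>\<^sub>2 (dist_X i x y)" using bounds by blast
    next
      fix i n :: nat and x and l :: "nat \<Rightarrow> real"
      assume "\<And>k. k < n \<Longrightarrow> x k \<in> X i - Z i" "finite_diameter (dist_X i) (x ` {..<n}) < 2 * R i"
        "(\<Sum>k<n. l k) = 0"
      then show "(\<Sum>k<n. \<Sum>m<n. l k * l m * K i (x k) (x m)) \<le> 0" by (intro neg[rule_format]) auto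
    qed
    show "a_T_menable \<Gamma>" by (rule embeddable_imp_a_T_menable)
  qed
qed

end
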